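(* Let $G$ be a simple connected graph of order $n$, minimum degree $\delta \geq k \geq 2$ and girth $g\geq 3$. Let $t=\lfloor \frac{g-1}{2}\rfloor$ and $\nu=\nu(\delta,g,k-1)$. If \[ q(\overline{G}) \leq \begin{cases} 2(n-1)-\frac{2}{n}(\nu+k-1)^{1+\frac{1}{t}}-\frac{2}{n}(n-\nu)^{1+\frac{1}{t}}-\frac{2}{n}(n+k-1) & \text{if } g=2t+1,\\[2mm] 2(n-1)-\frac{2}{n\cdot 2^{\frac{1}{t}}}(\nu+k-1)^{1+\frac{1}{t}}-\frac{2}{n\cdot 2^{\frac{1}{t}}}(n-\nu)^{1+\frac{1}{t}}-\frac{2}{n}(n+k-1) & \text{if } g=2t+2, \end{cases} \] then $G$ is $k$-connected.
   Context: $\overline{G}=K_n-E(G)$ is the complement of $G$. The girth $g$ of $G$ is the length of a shortest cycle. $q(H)$ denotes the $Q$-index of a graph $H$, i.e. the largest eigenvalue of $Q(H)=D(H)+A(H)$ ($D$ = diagonal degree matrix, $A$ = adjacency matrix). For positive integers $\delta,g,\kappa$ with $t=\lfloor\frac{g-1}{2}\rfloor$, define \[ \nu(\delta,g,\kappa)=\begin{cases} 1+(\delta-\kappa)\sum_{i=0}^{t-1}(\delta-1)^i & \text{if } g=2t+1,\\ 2+(2\delta-2-\kappa)\sum_{i=0}^{t-1}(\delta-1)^i & \text{if } g=2t+2 \text{ and } \delta\geq 3,\\ 2t+1 & \text{if } g=2t+2 \text{ and } \delta=2.\end{cases} \] A vertex subset $C$ of a connected graph $G$ is a vertex-cut if $G-C$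 is disconnected or $G-C=K_1$; $\kappa(G)$ is the minimum size of a vertex-cut. $G$ is $k$-connected if $\kappa(G)\geq k$. *)

theory Defs
  imports
    "Graph_Theory.Graph_Theory"
    "Jordan_Normal_Form.Spectral_Radius"
    "HOL-Library.Extended_Nat"
begin

text \<open>
  A finite simple graph is a \<^locale>\<open>pair_graph\<close>: each edge $uv$ is represented by the two arcs
  $(u,v)$ and $(v,u)$, so the degree of a vertex is its out-degree (equivalently its in-degree).
\<close>

definition complement_graph :: "'a pair_pre_digraph \<Rightarrow> 'a pair_pre_digraph" where
  "complement_graph G =
     \<lparr> pverts = pverts G,
       parcs = {(u, v). u \<in> pverts G \<and> v \<in> pverts G \<and> u \<noteq> v \<and> (u, v) \<notin> parcs G} \<rparr>"

definition min_degree :: "('a, 'b) pre_digraph \<Rightarrow> nat" where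
  "min_degree G = Min (out_degree G ` verts G)"

text \<open>
  The library's \<^const>\<open>pre_digraph.cycle\<close> admits the walk $u, v, u$ along the two arcs of one edge;
  the length bound excludes it. The girth of an acyclic graph is \<open>\<infinity>\<close>.
\<close>

definition girth :: "('a, 'b) pre_digraph \<Rightarrow> enat" where
  "girth G = (INF p \<in> {p. pre_digraph.cycle G p \<and> 3 \<le> length p}. enat (length p))"

text \<open>
  The subset is proper because the library counts the graph without vertices as not connected.
  The second disjunct is the case $G - C = K_1$.
\<close>

definition vertex_cut :: "('a, 'b) pre_digraph \<Rightarrow> 'a set \<Rightarrow> bool" where
  "vertex_cut G C \<longleftrightarrow>
     C \<subset> verts G \<and> (\<not> connected (G \<restriction> (verts G - C)) \<or> card (verts G - C) = 1)"

definition vertex_connectivity :: "('a, 'b) pre_digraph \<Rightarrow> nat" where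
  "vertex_connectivity G = Min (card ` {C. vertex_cut G C})"

definition k_connected :: "nat \<Rightarrow> ('a, 'b) pre_digraph \<Rightarrow> bool" where
  "k_connected k G \<longleftrightarrow> vertex_connectivity G \<ge> k"

text \<open>
  Matrices of a graph depend on an enumeration \<open>vs\<close> of its vertices. Different enumerations give
  permutation-similar matrices, so the spectrum, and hence \<open>Q_index\<close>, does not depend on the
  choice made in \<open>vertex_enum\<close>.
\<close>

definition adjacency_mat :: "('a, 'b) pre_digraph \<Rightarrow> 'a list \<Rightarrow> real mat" where
  "adjacency_mat H vs =
     mat (length vs) (length vs) (\<lambda>(i, j). if vs ! i \<rightarrow>\<^bsub>H\<^esub> vs ! j then 1 else 0)"

definition degree_mat :: "('a, 'b) pre_digraph \<Rightarrow> 'a list \<Rightarrow> real mat" where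
  "degree_mat H vs =
     mat (length vs) (length vs) (\<lambda>(i, j). if i = j then real (out_degree H (vs ! i)) else 0)"

definition signless_laplacian :: "('a, 'b) pre_digraph \<Rightarrow> 'a list \<Rightarrow> real mat" where
  "signless_laplacian H vs = degree_mat H vs + adjacency_mat H vs"

definition vertex_enum :: "('a, 'b) pre_digraph \<Rightarrow> 'a list" where
  "vertex_enum H = (SOME vs. distinct vs \<and> set vs = verts H)"

definition Q_index :: "('a, 'b) pre_digraph \<Rightarrow> real" where
  "Q_index H = Max (spectrum (signless_laplacian H (vertex_enum H)))"

text \<open>
  Integer-valued, since the differences may be negative for arbitrary arguments. The last branch is
  only meant for \<open>g\<close> even and \<open>\<delta> = 2\<close>; the value for even \<open>g\<close> and \<open>\<delta> < 2\<close> is a dummy.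
\<close>

definition nu :: "nat \<Rightarrow> nat \<Rightarrow> nat \<Rightarrow> int" where
  "nu \<delta> g \<kappa> =
     (let t = (g - 1) div 2 in
      if g = 2 * t + 1 then 1 + (int \<delta> - int \<kappa>) * (\<Sum>i<t. (int \<delta> - 1) ^ i)
      else if \<delta> \<ge> 3 then 2 + (2 * int \<delta> - 2 - int \<kappa>) * (\<Sum>i<t. (int \<delta> - 1) ^ i)
      else 2 * int t + 1)"

end

(*
  Let C be a vertex cut with fewer than k vertices, and let A and B be the two sides of G - C.
  Growing non-backtracking walks from a vertex (g odd) or an edge (g even) of A gives trees whose
  branches are pairwise disjoint by the girth condition; each vertex of C meets at most one branch,
  so |A|, |B| >= nu.

  The irregular Moore bound of Alon, Hoory and Linial says that a graph with N vertices, average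
  degree d >= 2 and girth above 2t (above 2t+1) satisfies (d-1)^t < N (respectively < N/2): with
  f_r(e) the number of non-backtracking walks continuing the arc e by r arcs, Jensen's inequality
  gives sum_e ln f_r(e) >= r * sum_v d(v) ln(d(v)-1), and x ln(x-1) is convex for x >= 2.
  Applied to A + C and B + C, which together carry all edges, and combined with the convexity of
  x^(1+1/t), it bounds the number of edges of G strictly from above. The Rayleigh quotient of the
  all-ones vector turns this into a lower bound on the Q-index of the complement that exceeds the
  hypothesis.
*)

theory Submission
  imports Defs "HOL-Analysis.Function_Topology" "HOL-Analysis.Convex"
begin

section \<open>Non-backtracking walks\<close>

text \<open>Passing to A + C costs degree: a vertex of C may keep few of its neighbours there, so
  neither minimum degree 2, on which the convexity argument rests, nor average degree 2 is
  guaranteed. Vertices with at most one neighbour are deleted, which does not lower an average of at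
  least 2; below average 2 the edge bound is immediate. Strictness comes from a vertex that the walk
  counts miss, and it is what contradicts a non-strict hypothesis. The constants: a = |A| + |C| and
  b = |B| + |C| satisfy a, b <= n - nu and a + b <= n + k - 1 = (nu + k - 1) + (n - nu), so the sum
  of the powers is at most its value at (nu + k - 1, n - nu). The terms linear in a and b add up to
  n + k - 1 and give the last summand of the hypothesis. The factor 2^(1/t) is the root of the 2 in
  the Moore bound for even girth.\<close>

fun nbw :: "('a \<times> 'a) set \<Rightarrow> 'a list \<Rightarrow> bool" where
  "nbw E [] = True"
| "nbw E [x] = True"
| "nbw E [x, y] = ((x, y) \<in> E)"
| "nbw E (x # y # z # ws) = ((x, y) \<in> E \<and> x \<noteq> z \<and> nbw E (y # z # ws))"

text \<open>A lower bound on an arc relation, instead of the girth of a graph, passes to every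
  subrelation, including acyclic ones.\<close>

definition girth_ge :: "nat \<Rightarrow> ('a \<times> 'a) set \<Rightarrow> bool" where
  "girth_ge g E \<longleftrightarrow>
     (\<forall>xs. distinct xs \<longrightarrow> nbw E xs \<longrightarrow> 3 \<le> length xs \<longrightarrow> (last xs, hd xs) \<in> E \<longrightarrow> g \<le> length xs)"

lemma nbw_mono: "nbw E xs \<Longrightarrow> E \<subseteq> F \<Longrightarrow> nbw F xs"
  by (induction E xs rule: nbw.induct) auto

lemma girth_ge_subset: "girth_ge g F \<Longrightarrow> E \<subseteq> F \<Longrightarrow> girth_ge g E"
  unfolding girth_ge_def using nbw_mono by blast

lemma nbw_ConsD: "nbw E (x # xs) \<Longrightarrow> nbw E xs"
  by (cases xs; cases "tl xs") auto

lemma nbw_Cons_arc: "nbw E (x # y # xs) \<Longrightarrow> (x, y) \<in> E"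
  by (cases xs) auto

lemma nbw_appendD1: "nbw E (xs @ ys) \<Longrightarrow> nbw E xs"
  by (induction E xs rule: nbw.induct) (auto dest: nbw_Cons_arc)

lemma nbw_appendD2: "nbw E (xs @ ys) \<Longrightarrow> nbw E ys"
  by (induction xs) (auto dest: nbw_ConsD)

text \<open>The overlap is an arc and not just a vertex: then any three consecutive vertices of the
  result lie in one of the two walks, so no turn at the joint has to be checked.\<close>

lemma nbw_join: "nbw E (xs @ [a, b]) \<Longrightarrow> nbw E (a # b # ys) \<Longrightarrow> nbw E (xs @ a # b # ys)"
proof (induction xs)
  case (Cons x xs)
  then have "nbw E (xs @ a # b # ys)"
    using nbw_ConsD[of E x "xs @ [a, b]"] by simp
  with Cons.prems(1) show ?case
    by (cases xs; cases "tl xs") auto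
qed simp

lemma nbw_rev: "sym E \<Longrightarrow> nbw E xs \<Longrightarrow> nbw E (rev xs)"
proof (induction E xs rule: nbw.induct)
  case (4 E x y z ws)
  have "nbw E (rev ws @ [z, y])" using 4 by simp
  moreover have "nbw E (z # y # [x])"
    using 4 nbw_Cons_arc[of E y z ws] by (auto dest: symD)
  ultimately show ?case using nbw_join[of E "rev ws" z y "[x]"] by simp
qed (auto dest: symD)

lemma nbw_last_arc: "nbw E (xs @ [x, y]) \<Longrightarrow> (x, y) \<in> E"
  using nbw_appendD2[of E xs "[x, y]"] by simp

text \<open>Once the tail is distinct, the head \<open>x\<close> recurs in it, and the segment
  before the recurrence is a cycle. It has at least three vertices: irreflexivity excludes
  \<open>x, x\<close> and non-backtracking excludes \<open>x, b, x\<close>. The length drops because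
  the second \<open>x\<close> is left out.\<close>

lemma nbw_not_distinct_cycle:
  assumes "irrefl E" "nbw E xs" "\<not> distinct xs"
  obtains ys where "distinct ys" "nbw E ys" "3 \<le> length ys" "(last ys, hd ys) \<in> E"
    "length ys < length xs"
  using assms(2,3)
proof (induction xs arbitrary: thesis)
  case (Cons x xs)
  show ?case
  proof (cases "distinct xs")
    case False
    with Cons nbw_ConsD[OF Cons.prems(2)] show ?thesis
      by (metis length_Cons less_SucI)
  next
    case True
    with Cons.prems obtain as bs where xs: "xs = as @ x # bs"
      by (metis distinct.simps(2) split_list)
    have nb: "nbw E (x # as @ [x])"
      using Cons.prems(2) nbw_appendD1[of E "x # as @ [x]" bs] xs by simp
    have "as \<noteq> []" using nb assms(1) by (auto simp: irrefl_def)
    then obtain cs b where as: "as = cs @ [b]" by (meson rev_exhaust)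
    have "cs \<noteq> []" using nb as by auto
    have "(last (x # as), x) \<in> E"
      using nb nbw_last_arc[of E "x # cs" b x] as by simp
    moreover have "nbw E (x # as)" using nbw_appendD1[of E "x # as" "[x]"] nb by simp
    moreover have "distinct (x # as)" using True xs by auto
    moreover have "3 \<le> length (x # as)" using as \<open>cs \<noteq> []\<close> by (cases cs) auto
    ultimately show ?thesis
      using Cons.prems(1)[of "x # as"] xs by simp
  qed
qed simp

text \<open>A list of at most \<open>g\<close> vertices has fewer than \<open>g\<close> arcs, too
  few to run through a cycle.\<close>

lemma nbw_distinct:
  assumes "irrefl E" "girth_ge g E" "nbw E xs" "length xs \<le> g"
  shows "distinct xs"
  using nbw_not_distinct_cycle[OF assms(1,3)] assms(2,4) unfolding girth_ge_def
  by (metis leD order_less_le_trans)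

lemma distinct_last_Cons: "distinct (v # p) \<Longrightarrow> last (v # p) = v \<Longrightarrow> p = []"
  by (cases p rule: rev_cases) auto

text \<open>Balls are trees up to the girth. After a common beginning is stripped, the two walks
  fork at \<open>v\<close>; one of them reversed and followed by the other does not backtrack at the
  fork and has at most \<open>g\<close> vertices. It is therefore distinct, which forbids a common
  end.\<close>

lemma nbw_last_inj:
  assumes "irrefl E" "sym E" "girth_ge g E"
    and "nbw E (v # p)" "nbw E (v # q)" "last (v # p) = last (v # q)" "length p + length q < g"
  shows "p = q"
  using assms(4-)
proof (induction p arbitrary: v q)
  case Nil
  then have "distinct (v # q)" using nbw_distinct[OF assms(1,3) Nil.prems(2)] by simp
  moreover have "last (v # q) = v" using Nil.prems(3) by simp
  ultimately show ?case by (rule distinct_last_Cons[symmetric])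
next
  case (Cons x p)
  show ?case
  proof (cases q)
    case q: Nil
    have "distinct (v # x # p)"
      using nbw_distinct[OF assms(1,3) Cons.prems(1)] Cons.prems(4) by simp
    moreover have "last (v # x # p) = v"
      unfolding Cons.prems(3) q by simp
    ultimately have "x # p = []" by (rule distinct_last_Cons)
    then show ?thesis by simp
  next
    case q: (Cons y q')
    show ?thesis
    proof (cases "x = y")
      case True
      have "p = q'"
      proof (rule Cons.IH)
        show "nbw E (x # p)" using Cons.prems(1) by (rule nbw_ConsD)
        show "nbw E (x # q')" using Cons.prems(2) unfolding q True by (rule nbw_ConsD)
        show "last (x # p) = last (x # q')" using Cons.prems(3) q True by simp
        show "length p + length q' < g" using Cons.prems(4) q by simp
      qed
      with q True show ?thesis by simp
    next
      case False
      have "nbw E (rev p @ [x, v])" using nbw_rev[OF assms(2) Cons.prems(1)] by simp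
      moreover have "nbw E (x # v # y # q')"
        using False symD[OF assms(2) nbw_Cons_arc[OF Cons.prems(1)]] Cons.prems(2)
        unfolding q by simp
      ultimately have "nbw E (rev p @ x # v # y # q')" by (rule nbw_join)
      then have d: "distinct (rev p @ x # v # y # q')"
        by (rule nbw_distinct[OF assms(1,3)]) (use Cons.prems(4) q in simp)
      have "last (x # p) \<in> set (x # p)" "last (y # q') \<in> set (y # q')"
        by (rule last_in_set; simp)+
      moreover have "last (x # p) = last (y # q')" using Cons.prems(3) q by simp
      moreover have "set (x # p) \<inter> set (y # q') = {}" using d by auto
      ultimately show ?thesis by (metis disjoint_iff)
    qed
  qed
qed

section \<open>Continuations of an arc\<close>

text \<open>The cardinality is the f_r of the overview. Only the \<open>r\<close> vertices behind
  \<open>v\<close> are stored, so an arc has exactly one continuation of length 0.\<close>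

definition walks :: "('a \<times> 'a) set \<Rightarrow> nat \<Rightarrow> 'a \<Rightarrow> 'a \<Rightarrow> 'a list set" where
  "walks E r u v = {p. length p = r \<and> nbw E (u # v # p)}"

lemma walks_0: "(u, v) \<in> E \<Longrightarrow> walks E 0 u v = {[]}"
  by (auto simp: walks_def)

lemma walks_Suc:
  assumes "(u, v) \<in> E"
  shows "walks E (Suc r) u v = (\<Union>w\<in>E `` {v} - {u}. (#) w ` walks E r v w)"
  using assms by (auto simp: walks_def length_Suc_conv image_iff dest: nbw_Cons_arc)

lemma finite_walks: "finite E \<Longrightarrow> finite (walks E r u v)"
proof (induction r arbitrary: u v)
  case 0
  then show ?case by (simp add: walks_def)
next
  case (Suc r)
  show ?case
  proof (cases "(u, v) \<in> E")
    case True
    with Suc show ?thesis by (auto simp: walks_Suc)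
  next
    case False
    then have "walks E (Suc r) u v = {}" by (auto simp: walks_def dest: nbw_Cons_arc)
    then show ?thesis by simp
  qed
qed

lemma card_walks_Suc:
  assumes "finite E" "(u, v) \<in> E"
  shows "card (walks E (Suc r) u v) = (\<Sum>w\<in>E `` {v} - {u}. card (walks E r v w))"
  unfolding walks_Suc[OF assms(2)]
  by (subst card_UN_disjoint)
    (use assms finite_walks[OF assms(1)] in \<open>auto simp: card_image intro: finite_imageI\<close>)

text \<open>Each step has at least \<open>\<delta> - 1\<close> choices that do not turn back. With
  \<open>\<delta> = 2\<close> this is the positivity under the logarithms further below.\<close>

lemma card_walks_ge:
  assumes "finite E" "sym E" "(u, v) \<in> E"
    and "\<And>x y. (x, y) \<in> E \<Longrightarrow> \<delta> \<le> card (E `` {x})"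
  shows "(\<delta> - 1) ^ r \<le> card (walks E r u v)"
  using assms(3)
proof (induction r arbitrary: u v)
  case 0
  then show ?case by (simp add: walks_0)
next
  case (Suc r)
  have vu: "(v, u) \<in> E" using Suc.prems assms(2) by (auto dest: symD)
  have "(\<delta> - 1) * (\<delta> - 1) ^ r \<le> card (E `` {v} - {u}) * (\<delta> - 1) ^ r"
    using assms(4)[OF vu] assms(1) vu by (intro mult_right_mono) (auto simp: card_Diff_singleton)
  also have "\<dots> = (\<Sum>w\<in>E `` {v} - {u}. (\<delta> - 1) ^ r)" by simp
  also have "\<dots> \<le> (\<Sum>w\<in>E `` {v} - {u}. card (walks E r v w))"
    by (intro sum_mono Suc.IH) auto
  finally show ?case using card_walks_Suc[OF assms(1) Suc.prems] by simp
qed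

section \<open>Branches of a tree grown inside the graph\<close>

text \<open>In the tree grown from \<open>u\<close>, this is the subtree behind the arc
  \<open>(u, v)\<close>, cut to \<open>t\<close> levels of which \<open>v\<close> is the
  first.\<close>

definition branch :: "('a \<times> 'a) set \<Rightarrow> nat \<Rightarrow> 'a \<Rightarrow> 'a \<Rightarrow> 'a set" where
  "branch E t u v = (\<lambda>p. last (v # p)) ` (\<Union>r<t. walks E r u v)"

lemma branchE:
  assumes "w \<in> branch E t u v"
  obtains p where "nbw E (u # v # p)" "length p < t" "w = last (v # p)"
  using assms unfolding branch_def walks_def by blast

lemma finite_branch: "finite E \<Longrightarrow> finite (branch E t u v)"
  by (simp add: branch_def finite_walks)

lemma card_branch:
  assumes "finite E" "irrefl E" "sym E" "girth_ge g E" "2 * t < g"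
  shows "card (branch E t u v) = (\<Sum>r<t. card (walks E r u v))"
proof -
  have "inj_on (\<lambda>p. last (v # p)) (\<Union>r<t. walks E r u v)"
  proof (rule inj_onI)
    fix p q
    assume "p \<in> (\<Union>r<t. walks E r u v)" "q \<in> (\<Union>r<t. walks E r u v)"
      and "last (v # p) = last (v # q)"
    then show "p = q"
      using assms(5) by (intro nbw_last_inj[OF assms(2-4)]) (auto simp: walks_def dest: nbw_ConsD)
  qed
  then have "card (branch E t u v) = card (\<Union>r<t. walks E r u v)"
    unfolding branch_def by (rule card_image)
  also have "\<dots> = (\<Sum>r<t. card (walks E r u v))"
    by (rule card_UN_disjoint) (use assms(1) finite_walks in \<open>auto simp: walks_def\<close>)
  finally show ?thesis .
qed

text \<open>Walks leave \<open>A\<close> only through \<open>C\<close>, and all vertices on the way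
  from \<open>v\<close> to a vertex of the branch belong to the branch themselves.\<close>

lemma branch_subset:
  assumes "u \<in> A" "branch E t u v \<inter> C = {}"
    and "\<And>a b. a \<in> A \<Longrightarrow> (a, b) \<in> E \<Longrightarrow> b \<in> A \<union> C"
  shows "branch E t u v \<subseteq> A"
proof -
  have "last (v # p) \<in> A" if "nbw E (u # v # p)" "length p < t" for p
    using that
  proof (induction p rule: rev_induct)
    case Nil
    then have "v \<in> branch E t u v" by (force simp: branch_def walks_def)
    with Nil assms show ?case using nbw_Cons_arc[of E u v "[]"] by auto
  next
    case (snoc w p)
    have "last (v # p) \<in> A"
      using snoc nbw_appendD1[of E "u # v # p" "[w]"] by simp
    moreover have "(last (v # p), w) \<in> E"
      using snoc.prems(1) nbw_last_arc[of E "u # butlast (v # p)" "last (v # p)" w]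
        append_butlast_last_id[of "v # p"]
      by (metis append_Cons append_assoc append.simps(1) list.distinct(1))
    moreover have "w \<in> branch E t u v"
      using snoc.prems unfolding branch_def walks_def
      by (intro image_eqI[of _ _ "p @ [w]"]) auto
    ultimately show ?case using assms by auto
  qed
  then show ?thesis by (auto elim!: branchE)
qed

text \<open>Disjoint branches that all start in \<open>A\<close>: each vertex of \<open>C\<close> spoils at most one of them, and
  the others stay inside \<open>A\<close>.\<close>

lemma card_region_ge:
  assumes "finite A" "finite C" "finite E" "finite F" "R \<subseteq> A"
    and region: "\<And>a b. a \<in> A \<Longrightarrow> (a, b) \<in> E \<Longrightarrow> b \<in> A \<union> C"
    and start: "\<And>u v. (u, v) \<in> F \<Longrightarrow> u \<in> A"
    and disj: "\<And>u v x y. (u, v) \<in> F \<Longrightarrow> (x, y) \<in> F \<Longrightarrow> (u, v) \<noteq> (x, y) \<Longrightarrow>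
                 branch E t u v \<inter> branch E t x y = {}"
    and root: "\<And>u v. (u, v) \<in> F \<Longrightarrow> branch E t u v \<inter> R = {}"
    and size: "\<And>u v. (u, v) \<in> F \<Longrightarrow> s \<le> card (branch E t u v)"
  shows "card R + (card F - card C) * s \<le> card A"
proof -
  let ?B = "\<lambda>a. branch E t (fst a) (snd a)"
  define H where "H = {a \<in> F. ?B a \<inter> C \<noteq> {}}"
  have "\<forall>a\<in>H. \<exists>c. c \<in> ?B a \<inter> C" by (auto simp: H_def)
  then obtain h where h: "\<And>a. a \<in> H \<Longrightarrow> h a \<in> ?B a \<inter> C" by metis
  have disj': "?B a \<inter> ?B b = {}" if "a \<in> F" "b \<in> F" "a \<noteq> b" for a b
    using disj[of "fst a" "snd a" "fst b" "snd b"] that by simp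
  have "inj_on h H"
  proof (rule inj_onI, rule ccontr)
    fix a b assume "a \<in> H" "b \<in> H" "h a = h b" "a \<noteq> b"
    moreover have "a \<in> F" "b \<in> F" using \<open>a \<in> H\<close> \<open>b \<in> H\<close> by (auto simp: H_def)
    ultimately show False using disj'[of a b] h[of a] h[of b] by auto
  qed
  then have "card H \<le> card C" using h assms(2) by (intro card_inj_on_le[of h]) auto
  moreover have "card (F - H) = card F - card H"
    using assms(4) by (intro card_Diff_subset) (auto simp: H_def intro: finite_subset)
  ultimately have "(card F - card C) * s \<le> card (F - H) * s"
    by (intro mult_right_mono) auto
  also have "\<dots> = (\<Sum>a\<in>F - H. s)" by simp
  also have "\<dots> \<le> (\<Sum>a\<in>F - H. card (?B a))"
    by (rule sum_mono) (use size in auto)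
  also have "\<dots> = card (\<Union>a\<in>F - H. ?B a)"
    by (rule card_UN_disjoint[symmetric]) (use assms(3,4) disj' finite_branch in auto)
  finally have "card R + (card F - card C) * s \<le> card R + card (\<Union>a\<in>F - H. ?B a)" by simp
  also have "\<dots> = card (R \<union> (\<Union>a\<in>F - H. ?B a))"
    by (rule card_Un_disjoint[symmetric])
      (use assms(1,3,4,5) root finite_branch finite_subset in \<open>fastforce+\<close>)
  also have "\<dots> \<le> card A"
  proof (rule card_mono[OF assms(1)])
    have "?B a \<subseteq> A" if "a \<in> F - H" for a
    proof (rule branch_subset[OF _ _ region])
      show "fst a \<in> A" using start[of "fst a" "snd a"] that by simp
      show "?B a \<inter> C = {}" using that by (auto simp: H_def)
    qed
    with assms(5) show "R \<union> (\<Union>a\<in>F - H. ?B a) \<subseteq> A" by blast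
  qed
  finally show ?thesis .
qed

section \<open>Parts of a disconnected graph\<close>

text \<open>The root is the vertex \<open>u\<close> and the branches lie behind its arcs. A vertex
  common to two branches would be reached from \<open>u\<close> by two walks of at most
  \<open>t\<close> arcs each, and \<open>2 * t < g\<close>.\<close>

lemma region_card_odd:
  assumes "finite A" "finite C" "finite E" "irrefl E" "sym E" "girth_ge g E" "2 * t < g"
    and deg: "\<And>x y. (x, y) \<in> E \<Longrightarrow> \<delta> \<le> card (E `` {x})"
    and region: "\<And>a b. a \<in> A \<Longrightarrow> (a, b) \<in> E \<Longrightarrow> b \<in> A \<union> C"
    and u: "u \<in> A" "\<delta> \<le> card (E `` {u})" "card C \<le> \<kappa>"
  shows "1 + (\<delta> - \<kappa>) * (\<Sum>i<t. (\<delta> - 1) ^ i) \<le> card A"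
proof -
  define F where "F = {u} \<times> E `` {u}"
  have "card {u} + (card F - card C) * (\<Sum>i<t. (\<delta> - 1) ^ i) \<le> card A"
  proof (rule card_region_ge[OF assms(1-3) _ _ region])
    show "finite F" using assms(3) by (auto simp: F_def)
    show "{u} \<subseteq> A" using u by simp
    show "x \<in> A" if "(x, y) \<in> F" for x y using that u by (auto simp: F_def)
    show "branch E t x y \<inter> branch E t x' y' = {}"
      if "(x, y) \<in> F" "(x', y') \<in> F" "(x, y) \<noteq> (x', y')" for x y x' y'
    proof -
      have "False" if w: "w \<in> branch E t u y" "w \<in> branch E t u y'" and ne: "y \<noteq> y'" for w
      proof -
        from w obtain p q where pq: "nbw E (u # y # p)" "length p < t" "w = last (y # p)"
          "nbw E (u # y' # q)" "length q < t" "w = last (y' # q)"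
          by (elim branchE)
        then have "y # p = y' # q"
          using assms(7) by (intro nbw_last_inj[OF assms(4-6), of u]) auto
        with ne show False by simp
      qed
      with that show ?thesis by (auto simp: F_def)
    qed
    show "branch E t x y \<inter> {u} = {}" if "(x, y) \<in> F" for x y
    proof -
      have "u \<notin> branch E t u y"
      proof
        assume "u \<in> branch E t u y"
        then obtain p where p: "nbw E (u # y # p)" "length p < t" "u = last (y # p)"
          by (elim branchE)
        then have "y # p = []"
          using assms(7) by (intro nbw_last_inj[OF assms(4-6), of u]) auto
        then show False by simp
      qed
      with that show ?thesis by (auto simp: F_def)
    qed
    show "(\<Sum>i<t. (\<delta> - 1) ^ i) \<le> card (branch E t x y)" if "(x, y) \<in> F" for x y
      unfolding card_branch[OF assms(3-7)]
      using that by (intro sum_mono card_walks_ge[OF assms(3,5) _ deg]) (auto simp: F_def)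
  qed
  moreover have "\<delta> - \<kappa> \<le> card F - card C"
    using u by (simp add: F_def card_cartesian_product)
  ultimately have "card {u} + (\<delta> - \<kappa>) * (\<Sum>i<t. (\<delta> - 1) ^ i) \<le> card A"
    by (meson add_left_mono le_trans mult_le_mono1)
  then show ?thesis by simp
qed

text \<open>The root is the edge \<open>uv\<close>, each end of which carries at least
  \<open>\<delta> - 1\<close> branches. One more level of girth keeps the branches at opposite ends
  apart.\<close>

lemma region_card_even:
  assumes "finite A" "finite C" "finite E" "irrefl E" "sym E" "girth_ge g E" "2 * t + 1 < g"
    and deg: "\<And>x y. (x, y) \<in> E \<Longrightarrow> \<delta> \<le> card (E `` {x})"
    and region: "\<And>a b. a \<in> A \<Longrightarrow> (a, b) \<in> E \<Longrightarrow> b \<in> A \<union> C"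
    and uv: "u \<in> A" "v \<in> A" "(u, v) \<in> E" "card C \<le> \<kappa>"
  shows "2 + (2 * \<delta> - 2 - \<kappa>) * (\<Sum>i<t. (\<delta> - 1) ^ i) \<le> card A"
proof -
  define F where "F = {u} \<times> (E `` {u} - {v}) \<union> {v} \<times> (E `` {v} - {u})"
  have vu: "(v, u) \<in> E" using uv assms(5) by (auto dest: symD)
  have neq: "u \<noteq> v" using uv assms(4) by (auto simp: irrefl_def)
  have t: "2 * t < g" using assms(7) by simp
  have same: "y = y'" if w: "w \<in> branch E t x y" "w \<in> branch E t x y'" for x y y' w
  proof -
    from w obtain p q where pq: "nbw E (x # y # p)" "length p < t" "w = last (y # p)"
      "nbw E (x # y' # q)" "length q < t" "w = last (y' # q)"
      by (elim branchE)
    then have "y # p = y' # q"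
      using t by (intro nbw_last_inj[OF assms(4-6), of x]) auto
    then show ?thesis by simp
  qed
  \<comment> \<open>The walk from \<open>x'\<close> is prolonged by the arc \<open>(x, x')\<close>
    so that both walks start at \<open>x\<close>; together they have at most
    \<open>2 * t + 1\<close> arcs.\<close>
  have opp: "branch E t x y \<inter> branch E t x' y' = {}"
    if "(x, x') \<in> E" "y \<noteq> x'" "y' \<noteq> x" for x x' y y'
  proof -
    have False if w: "w \<in> branch E t x y" "w \<in> branch E t x' y'" for w
    proof -
      from w obtain p q where pq: "nbw E (x # y # p)" "length p < t" "w = last (y # p)"
        "nbw E (x' # y' # q)" "length q < t" "w = last (y' # q)"
        by (elim branchE)
      have "nbw E (x # x' # y' # q)" using pq \<open>(x, x') \<in> E\<close> \<open>y' \<noteq> x\<close> by simp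
      then have "y # p = x' # y' # q"
        using pq assms(7) by (intro nbw_last_inj[OF assms(4-6), of x]) auto
      with \<open>y \<noteq> x'\<close> show False by simp
    qed
    then show ?thesis by auto
  qed
  have tip: "x \<notin> branch E t x y" for x y
  proof
    assume "x \<in> branch E t x y"
    then obtain p where p: "nbw E (x # y # p)" "length p < t" "x = last (y # p)"
      by (elim branchE)
    then have "y # p = []"
      using t by (intro nbw_last_inj[OF assms(4-6), of x]) auto
    then show False by simp
  qed
  have tip2: "x' \<notin> branch E t x y" if "(x, x') \<in> E" "y \<noteq> x'" for x x' y
  proof
    assume "x' \<in> branch E t x y"
    then obtain p where p: "nbw E (x # y # p)" "length p < t" "x' = last (y # p)"
      by (elim branchE)
    then have "y # p = [x']"
      using assms(7) that by (intro nbw_last_inj[OF assms(4-6), of x]) auto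
    with that show False by simp
  qed
  have "card {u, v} + (card F - card C) * (\<Sum>i<t. (\<delta> - 1) ^ i) \<le> card A"
  proof (rule card_region_ge[OF assms(1-3) _ _ region])
    show "finite F" using assms(3) by (auto simp: F_def)
    show "{u, v} \<subseteq> A" using uv by simp
    show "x \<in> A" if "(x, y) \<in> F" for x y using that uv by (auto simp: F_def)
    show "branch E t x y \<inter> branch E t x' y' = {}"
      if "(x, y) \<in> F" "(x', y') \<in> F" "(x, y) \<noteq> (x', y')" for x y x' y'
      using that same[of _ u y y'] same[of _ v y y'] opp[OF uv(3), of y y'] opp[OF vu, of y y']
      unfolding F_def by auto
    show "branch E t x y \<inter> {u, v} = {}" if "(x, y) \<in> F" for x y
      using that tip tip2[OF uv(3)] tip2[OF vu] unfolding F_def by auto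
    show "(\<Sum>i<t. (\<delta> - 1) ^ i) \<le> card (branch E t x y)" if "(x, y) \<in> F" for x y
      unfolding card_branch[OF assms(3-6) t]
      using that by (intro sum_mono card_walks_ge[OF assms(3,5) _ deg]) (auto simp: F_def)
  qed
  moreover have "2 * \<delta> - 2 - \<kappa> \<le> card F - card C"
  proof -
    have "card F = card (E `` {u} - {v}) + card (E `` {v} - {u})"
      unfolding F_def using neq assms(3)
      by (subst card_Un_disjoint) (auto simp: card_cartesian_product)
    moreover have "card (E `` {u} - {v}) = card (E `` {u}) - 1"
      "card (E `` {v} - {u}) = card (E `` {v}) - 1"
      using uv vu by (auto simp: card_Diff_singleton)
    ultimately show ?thesis using deg[OF uv(3)] deg[OF vu] uv(4) by linarith
  qed
  ultimately have "card {u, v} + (2 * \<delta> - 2 - \<kappa>) * (\<Sum>i<t. (\<delta> - 1) ^ i) \<le> card A"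
    by (meson add_left_mono le_trans mult_le_mono1)
  with neq show ?thesis by simp
qed

text \<open>A longest path in \<open>A \<union> C\<close> has an end in \<open>A\<close>, whose second neighbour closes a cycle.\<close>

lemma region_card_cycle:
  assumes "finite A" "finite C" "irrefl E" "sym E" "girth_ge g E"
    and deg: "\<And>x. x \<in> A \<Longrightarrow> 2 \<le> card (E `` {x})"
    and region: "\<And>a b. a \<in> A \<Longrightarrow> (a, b) \<in> E \<Longrightarrow> b \<in> A \<union> C"
    and A: "A \<noteq> {}" "card C \<le> 1"
  shows "g \<le> card A + 1"
proof -
  \<comment> \<open>Confined to these arcs, the cycle found at the end has at most
    \<open>card A + 1\<close> vertices.\<close>
  let ?E = "E \<inter> (A \<union> C) \<times> (A \<union> C)"
  define P where "P p \<longleftrightarrow> distinct p \<and> nbw ?E p \<and> set p \<subseteq> A \<union> C \<and> 2 \<le> length p" for p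
  have irr: "irrefl ?E" and sym: "sym ?E"
    using assms(3,4) by (auto simp: irrefl_def sym_def)
  have fin: "finite (A \<union> C)" using assms by simp
  have Csub: "c = c'" if "c \<in> C" "c' \<in> C" for c c'
    using A(2) that card_le_Suc0_iff_eq[OF assms(2)] by simp
  have bound: "length p < Suc (card (A \<union> C))" if "P p" for p
    using that card_mono[OF fin, of "set p"] distinct_card[of p] by (auto simp: P_def)
  obtain a where a: "a \<in> A" using A by auto
  have "E `` {a} \<noteq> {}" using deg[OF a] by auto
  then obtain b where b: "(a, b) \<in> E" by auto
  have "P [a, b]" using a b region[OF a b] assms(3) by (auto simp: P_def irrefl_def)
  then obtain p where p: "P p" and pmax: "\<And>q. P q \<Longrightarrow> length q \<le> length p"
    using ex_has_greatest_nat[of P "[a, b]" length "Suc (card (A \<union> C))"] bound less_imp_le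
    by blast
  have "\<exists>q. P q \<and> length q = length p \<and> last q \<in> A"
  proof (cases "last p \<in> A")
    case False
    have ne: "p \<noteq> []" using p by (auto simp: P_def)
    have "P (rev p)" using p nbw_rev[OF sym] by (auto simp: P_def)
    moreover have "last (rev p) \<in> A"
    \<comment> \<open>Two ends outside \<open>A\<close> would both be the only vertex of
      \<open>C\<close>, but a path with at least two vertices has distinct ends.\<close>
    proof (rule ccontr)
      assume "last (rev p) \<notin> A"
      then have "hd p \<in> C" "last p \<in> C"
        using False p ne subsetD[OF _ hd_in_set[OF ne], of "A \<union> C"]
          subsetD[OF _ last_in_set[OF ne], of "A \<union> C"]
        by (auto simp: P_def last_rev)
      then have "hd p = last p" using Csub by auto
      moreover have "distinct p" "2 \<le> length p" using p by (auto simp: P_def)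
      ultimately show False
        by (cases p; cases "tl p" rule: rev_cases) auto
    qed
    ultimately show ?thesis by (intro exI[of _ "rev p"]) simp
  qed (use p in auto)
  then obtain q where q: "P q" "length q = length p" "last q \<in> A" by auto
  obtain r x y where r: "q = r @ [x, y]"
  proof -
    have "2 \<le> length q" using q by (auto simp: P_def)
    then show ?thesis
      using that by (cases q rule: rev_cases; cases "butlast q" rule: rev_cases) auto
  qed
  have y: "y \<in> A" using q r by simp
  have "\<not> E `` {y} \<subseteq> {x}"
    using deg[OF y] card_mono[of "{x}" "E `` {y}"] by auto
  then obtain z where z: "(y, z) \<in> E" "z \<noteq> x" by auto
  have zA: "z \<in> A \<union> C" using region[OF y z(1)] .
  have yz: "nbw ?E (x # y # [z])"
    using z zA y q(1) r nbw_last_arc[of ?E r x y] by (auto simp: P_def)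
  have nb: "nbw ?E (r @ x # y # [z])"
    by (rule nbw_join) (use q(1) r yz in \<open>auto simp: P_def\<close>)
  have "\<not> distinct (r @ x # y # [z])"
  proof
    assume "distinct (r @ x # y # [z])"
    then have "P (r @ x # y # [z])"
      using nb zA q(1) r by (auto simp: P_def)
    from pmax[OF this] q(2) r show False by simp
  qed
  then obtain ys where ys: "distinct ys" "nbw ?E ys" "3 \<le> length ys" "(last ys, hd ys) \<in> ?E"
    using nbw_not_distinct_cycle[OF irr nb] by blast
  have "set xs \<subseteq> A \<union> C" if "nbw ?E xs" "2 \<le> length xs" for xs
    using that by (induction ?E xs rule: nbw.induct) auto
  then have "set ys \<subseteq> A \<union> C" using ys by auto
  then have "length ys \<le> card (A \<union> C)"
    using card_mono[OF fin, of "set ys"] distinct_card[OF ys(1)] by simp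
  also have "\<dots> \<le> card A + 1" using card_Un_le[of A C] A(2) by linarith
  finally have "length ys \<le> card A + 1" .
  moreover have "g \<le> length ys"
    using ys girth_ge_subset[OF assms(5), of ?E] unfolding girth_ge_def by auto
  ultimately show ?thesis by simp
qed

section \<open>Counting non-backtracking walks\<close>

lemma sum_arcs_swap:
  fixes f :: "'a \<Rightarrow> 'a \<Rightarrow> 'b::comm_monoid_add"
  assumes "finite S" "E \<subseteq> S \<times> S" "sym E"
  shows "(\<Sum>v\<in>S. \<Sum>u\<in>E `` {v}. f u v) = (\<Sum>v\<in>S. \<Sum>u\<in>E `` {v}. f v u)"
proof -
  have 1: "E `` {v} = {u \<in> S. (u, v) \<in> E}" and 2: "E `` {v} = {u \<in> S. (v, u) \<in> E}" for v
    using assms(2,3) by (auto dest: symD)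
  have "(\<Sum>v\<in>S. \<Sum>u\<in>E `` {v}. f u v) = (\<Sum>v\<in>S. \<Sum>u\<in>{u \<in> S. (u, v) \<in> E}. f u v)"
    by (simp only: 1[symmetric])
  also have "\<dots> = (\<Sum>u\<in>S. \<Sum>v\<in>{v \<in> S. (u, v) \<in> E}. f u v)"
    using assms(1) by (intro sum.swap_restrict)
  finally show ?thesis by (simp only: 2[symmetric])
qed

section \<open>Jensen's inequality and walk counts\<close>

text \<open>The tangent of \<open>ln\<close> at the mean \<open>m\<close> lies above the graph, and
  its linear terms \<open>f x / m - 1\<close> add up to 0.\<close>

lemma sum_ln_le_ln_mean:
  fixes f :: "'a \<Rightarrow> real"
  assumes "finite X" "X \<noteq> {}" "\<And>x. x \<in> X \<Longrightarrow> 0 < f x"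
  shows "(\<Sum>x\<in>X. ln (f x)) \<le> card X * ln ((\<Sum>x\<in>X. f x) / card X)"
proof -
  define m where "m = (\<Sum>x\<in>X. f x) / card X"
  have c: "0 < real (card X)" using assms by (simp add: card_gt_0_iff)
  have m: "0 < m" unfolding m_def using assms c by (intro divide_pos_pos sum_pos) auto
  have "ln (f x) \<le> ln m + (f x / m - 1)" if "x \<in> X" for x
    using ln_le_minus_one[of "f x / m"] assms(3)[OF that] m by (simp add: ln_div)
  then have "(\<Sum>x\<in>X. ln (f x)) \<le> (\<Sum>x\<in>X. ln m + (f x / m - 1))" by (rule sum_mono)
  also have "\<dots> = card X * ln m + ((\<Sum>x\<in>X. f x) / m - card X)"
    by (simp add: sum.distrib sum_subtractf sum_divide_distrib)
  also have "(\<Sum>x\<in>X. f x) / m = card X" using m c unfolding m_def by (auto simp: field_simps)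
  finally show ?thesis by (simp add: m_def)
qed

text \<open>The second derivative (x - 2) / (x - 1)^2 changes sign at 2, which is where the degree
  condition 2 originates.\<close>

lemma convex_on_times_ln_minus_one: "convex_on {2..} (\<lambda>x::real. x * ln (x - 1))"
proof (rule f''_ge0_imp_convex)
  fix x :: real assume x: "x \<in> {2..}"
  then have "1 < x" by simp
  then show "((\<lambda>x. x * ln (x - 1)) has_real_derivative ln (x - 1) + x / (x - 1)) (at x)"
    by (auto intro!: derivative_eq_intros)
  have "((\<lambda>x. ln (x - 1) + x / (x - 1)) has_real_derivative
      1 / (x - 1) + ((x - 1) - x) / ((x - 1) * (x - 1))) (at x)"
    using \<open>1 < x\<close> by (auto intro!: derivative_eq_intros)
  also have "1 / (x - 1) + ((x - 1) - x) / ((x - 1) * (x - 1)) = (x - 2) / (x - 1)\<^sup>2"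
    using \<open>1 < x\<close> by (simp add: divide_simps power2_eq_square)
  finally show "((\<lambda>x. ln (x - 1) + x / (x - 1)) has_real_derivative (x - 2) / (x - 1)\<^sup>2) (at x)" .
  show "0 \<le> (x - 2) / (x - 1)\<^sup>2" using x by simp
qed simp

lemma mean_ln_minus_one_le:
  fixes d :: "'a \<Rightarrow> real"
  assumes "finite S" "S \<noteq> {}" "\<And>v. v \<in> S \<Longrightarrow> 2 \<le> d v"
  shows "(\<Sum>v\<in>S. d v) * ln ((\<Sum>v\<in>S. d v) / card S - 1) \<le> (\<Sum>v\<in>S. d v * ln (d v - 1))"
proof -
  have c: "0 < real (card S)" using assms by (simp add: card_gt_0_iff)
  have "(\<Sum>v\<in>S. (1 / card S) *\<^sub>R d v) * ln ((\<Sum>v\<in>S. (1 / card S) *\<^sub>R d v) - 1)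
      \<le> (\<Sum>v\<in>S. 1 / card S * (d v * ln (d v - 1)))"
    by (rule convex_on_sum[OF assms(1,2) convex_on_times_ln_minus_one]) (use assms c in auto)
  then have "(\<Sum>v\<in>S. d v) / card S * ln ((\<Sum>v\<in>S. d v) / card S - 1)
      \<le> (\<Sum>v\<in>S. d v * ln (d v - 1)) / card S"
    by (simp add: sum_divide_distrib)
  with c show ?thesis by (simp add: field_simps)
qed

text \<open>Each \<open>w\<close> is omitted only for \<open>u = w\<close>.\<close>

lemma sum_sum_Diff_singleton:
  fixes h :: "'a \<Rightarrow> real"
  assumes "finite X"
  shows "(\<Sum>u\<in>X. \<Sum>w\<in>X - {u}. h w) = (real (card X) - 1) * (\<Sum>w\<in>X. h w)"
proof -
  have "(\<Sum>u\<in>X. \<Sum>w\<in>X - {u}. h w) = (\<Sum>u\<in>X. (\<Sum>w\<in>X. h w) - h u)"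
    by (rule sum.cong) (use assms in \<open>auto simp: sum_diff1\<close>)
  then show ?thesis by (simp add: sum_subtractf algebra_simps)
qed

text \<open>The double sums run over the arcs \<open>(u, v)\<close>, grouped by the head
  \<open>v\<close>. Since f_(r+1) of \<open>(u, v)\<close> is the sum of f_r over the arcs
  \<open>(v, w)\<close> with \<open>w \<noteq> u\<close>, concavity bounds its logarithm below by ln
  (d(v) - 1) plus the mean of the logarithms of the summands. Each step thus contributes one sum of
  d(v) ln (d(v) - 1).\<close>

lemma sum_ln_walks_ge:
  assumes "finite S" "E \<subseteq> S \<times> S" "sym E"
    and deg: "\<And>v. v \<in> S \<Longrightarrow> 2 \<le> card (E `` {v})"
  shows "r * (\<Sum>v\<in>S. \<Sum>u\<in>E `` {v}. ln (real (card (E `` {v})) - 1))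
    \<le> (\<Sum>v\<in>S. \<Sum>u\<in>E `` {v}. ln (real (card (walks E r u v))))"
proof (induction r)
  case 0
  have "(\<Sum>v\<in>S. \<Sum>u\<in>E `` {v}. ln (real (card (walks E 0 u v)))) = 0"
    by (intro sum.neutral ballI) (use assms(3) in \<open>auto simp: walks_0 dest: symD\<close>)
  then show ?case by simp
next
  case (Suc r)
  have fE: "finite E" using assms(1,2) finite_subset by blast
  have fN: "finite (E `` {v})" for v using fE by auto
  let ?d = "\<lambda>v. real (card (E `` {v}))"
  let ?h = "\<lambda>v w. ln (real (card (walks E r v w)))"
  have pos: "0 < card (walks E r v w)" if "(v, w) \<in> E" for v w
  proof -
    have "(2 - 1) ^ r \<le> card (walks E r v w)"
      by (rule card_walks_ge[OF fE assms(3) that]) (use deg assms(2) in auto)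
    then show ?thesis by simp
  qed
  have "ln (?d v - 1) + (\<Sum>w\<in>E `` {v} - {u}. ?h v w) / (?d v - 1)
      \<le> ln (real (card (walks E (Suc r) u v)))" if v: "v \<in> S" and "u \<in> E `` {v}" for u v
  proof -
    have uv: "(u, v) \<in> E" using that assms(3) by (auto dest: symD)
    let ?X = "E `` {v} - {u}"
    have cX: "real (card ?X) = ?d v - 1"
      using deg[OF v] that(2) fN by (simp add: card_Diff_singleton)
    have X: "finite ?X" using fN by simp
    have pX: "0 < real (card ?X)" using cX deg[OF v] by linarith
    then have X0: "?X \<noteq> {}" by (metis card.empty of_nat_0 less_irrefl)
    have p: "0 < (\<Sum>w\<in>?X. real (card (walks E r v w)))"
      using X X0 pos by (intro sum_pos) auto
    have "(\<Sum>w\<in>?X. ?h v w) \<le> card ?X * ln ((\<Sum>w\<in>?X. real (card (walks E r v w))) / card ?X)"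
      by (rule sum_ln_le_ln_mean[OF X X0]) (use pos in auto)
    also have "\<dots> = card ?X * (ln (\<Sum>w\<in>?X. real (card (walks E r v w))) - ln (card ?X))"
      using p pX by (simp add: ln_div)
    finally have "(\<Sum>w\<in>?X. ?h v w) / card ?X
        \<le> ln (\<Sum>w\<in>?X. real (card (walks E r v w))) - ln (card ?X)"
      using pX by (simp add: field_simps)
    then show ?thesis
      unfolding card_walks_Suc[OF fE uv] cX by simp
  qed
  then have "(\<Sum>v\<in>S. \<Sum>u\<in>E `` {v}. ln (?d v - 1) + (\<Sum>w\<in>E `` {v} - {u}. ?h v w) / (?d v - 1))
      \<le> (\<Sum>v\<in>S. \<Sum>u\<in>E `` {v}. ln (real (card (walks E (Suc r) u v))))"
    by (intro sum_mono) simp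
  \<comment> \<open>The means telescope: the arc \<open>(v, w)\<close> occurs for d(v) - 1
    predecessors \<open>u\<close>, which cancels the denominator, and reversing the arcs restores
    the old sum.\<close>
  moreover have "(\<Sum>v\<in>S. \<Sum>u\<in>E `` {v}. (\<Sum>w\<in>E `` {v} - {u}. ?h v w) / (?d v - 1))
      = (\<Sum>v\<in>S. \<Sum>u\<in>E `` {v}. ?h u v)"
  proof -
    have "(\<Sum>u\<in>E `` {v}. (\<Sum>w\<in>E `` {v} - {u}. ?h v w) / (?d v - 1)) = (\<Sum>w\<in>E `` {v}. ?h v w)"
      if "v \<in> S" for v
      using sum_sum_Diff_singleton[OF fN, of "?h v" v] deg[OF that]
      by (simp flip: sum_divide_distrib)
    then show ?thesis using sum_arcs_swap[OF assms(1-3), of ?h] by simp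
  qed
  ultimately show ?case
    using Suc by (simp add: sum.distrib algebra_simps)
qed

text \<open>For a symmetric relation \<open>card E\<close> is twice the number of edges, so
  \<open>card E / card S\<close> is the average degree without a factor 2.\<close>

lemma card_arcs: "finite S \<Longrightarrow> E \<subseteq> S \<times> S \<Longrightarrow> card E = (\<Sum>v\<in>S. card (E `` {v}))"
proof -
  assume a: "finite S" "E \<subseteq> S \<times> S"
  then have "finite E" using finite_subset by blast
  have "E = (SIGMA v:S. E `` {v})" using a by auto
  then have "card E = card (SIGMA v:S. E `` {v})" by simp
  also have "\<dots> = (\<Sum>v\<in>S. card (E `` {v}))"
    using a \<open>finite E\<close> by (intro card_SigmaI) auto
  finally show ?thesis .
qed

text \<open>Alon, Hoory and Linial: the average degree bounds the number of walks from below as it would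
  in a regular graph.\<close>

lemma sum_walks_ge:
  assumes "finite S" "S \<noteq> {}" "E \<subseteq> S \<times> S" "sym E"
    and deg: "\<And>v. v \<in> S \<Longrightarrow> 2 \<le> card (E `` {v})"
  shows "card E * (card E / card S - 1) ^ r \<le> (\<Sum>v\<in>S. \<Sum>u\<in>E `` {v}. real (card (walks E r u v)))"
proof -
  let ?M = "real (card E)" and ?N = "real (card S)"
  let ?W = "\<Sum>v\<in>S. \<Sum>u\<in>E `` {v}. real (card (walks E r u v))"
  define X where "X = (SIGMA v:S. E `` {v})"
  have fE: "finite E" using assms(1,3) finite_subset by blast
  have fN: "finite (E `` {v})" for v using fE by auto
  have N: "0 < ?N" using assms(1,2) by (simp add: card_gt_0_iff)
  have M: "?M = (\<Sum>v\<in>S. real (card (E `` {v})))" using card_arcs[OF assms(1,3)] by simp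
  have "2 * ?N \<le> ?M" unfolding M using sum_mono[of S "\<lambda>_. 2" "\<lambda>v. real (card (E `` {v}))"] deg
    by (force simp: mult.commute)
  then have q: "1 \<le> ?M / ?N - 1" and M0: "0 < ?M" using N by (auto simp: field_simps)
  have X: "finite X" "real (card X) = ?M" unfolding X_def using fN assms(1) M by auto
  have X0: "X \<noteq> {}" using X(2) M0 by (metis card.empty of_nat_0 less_irrefl)
  have pos: "0 < card (walks E r u v)" if "(v, u) \<in> X" for v u
  proof -
    have "(u, v) \<in> E" using that assms(4) by (auto simp: X_def dest: symD)
    then have "(2 - 1) ^ r \<le> card (walks E r u v)"
      by (rule card_walks_ge[OF fE assms(4)]) (use deg assms(3) in auto)
    then show ?thesis by simp
  qed
  have "?M * (r * ln (?M / ?N - 1)) = r * (?M * ln (?M / ?N - 1))" by simp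
  also have "\<dots> \<le> r * (\<Sum>v\<in>S. real (card (E `` {v})) * ln (real (card (E `` {v})) - 1))"
    using mean_ln_minus_one_le[OF assms(1,2), of "\<lambda>v. real (card (E `` {v}))"] deg
    unfolding M[symmetric] by (intro mult_left_mono) force+
  also have "\<dots> \<le> (\<Sum>v\<in>S. \<Sum>u\<in>E `` {v}. ln (real (card (walks E r u v))))"
    using sum_ln_walks_ge[OF assms(1,3,4) deg, of r] by simp
  also have "\<dots> = (\<Sum>x\<in>X. ln (real (card (walks E r (snd x) (fst x)))))"
    unfolding X_def using assms(1) fN by (simp add: sum.Sigma case_prod_unfold)
  \<comment> \<open>Jensen again, now over all arcs at once; exponentiating then bounds the
    arithmetic mean of the walk counts.\<close>
  also have "\<dots> \<le> card X * ln ((\<Sum>x\<in>X. real (card (walks E r (snd x) (fst x)))) / card X)"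
    by (rule sum_ln_le_ln_mean[OF X(1) X0]) (use pos in auto)
  also have "(\<Sum>x\<in>X. real (card (walks E r (snd x) (fst x)))) = ?W"
    unfolding X_def using assms(1) fN by (simp add: sum.Sigma case_prod_unfold)
  finally have "r * ln (?M / ?N - 1) \<le> ln (?W / ?M)" using M0 unfolding X(2) by simp
  then have "ln ((?M / ?N - 1) ^ r) \<le> ln (?W / ?M)" using q by (simp add: ln_realpow)
  moreover have "0 < ?W"
  proof -
    have "0 < (\<Sum>x\<in>X. real (card (walks E r (snd x) (fst x))))"
      using X(1) X0 pos by (intro sum_pos) auto
    then show ?thesis unfolding X_def using assms(1) fN by (simp add: sum.Sigma case_prod_unfold)
  qed
  ultimately have "(?M / ?N - 1) ^ r \<le> ?W / ?M"
    using q M0 by (subst (asm) ln_le_cancel_iff) auto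
  then show ?thesis using M0 by (simp add: field_simps)
qed

section \<open>The Moore bound for irregular graphs\<close>

lemma nbw_subset: "E \<subseteq> S \<times> S \<Longrightarrow> nbw E (u # v # p) \<Longrightarrow> set (u # v # p) \<subseteq> S"
proof (induction p arbitrary: u v)
  case (Cons w p)
  then have "set (v # w # p) \<subseteq> S" "(u, v) \<in> E"
    by (metis nbw_ConsD, metis nbw_Cons_arc)
  with Cons.prems(1) show ?case by auto
qed auto

text \<open>The walks of \<open>Suc r\<close> arcs from \<open>v\<close> have different ends, none
  of which is \<open>v\<close>.\<close>

lemma sum_walks_vertex_le:
  assumes "finite S" "E \<subseteq> S \<times> S" "irrefl E" "sym E" "girth_ge g E" "2 * Suc r < g" "v \<in> S"
  shows "(\<Sum>u\<in>E `` {v}. card (walks E r v u)) \<le> card S - 1"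
proof -
  have fE: "finite E" using assms(1,2) finite_subset by blast
  define X where "X = (\<Union>u\<in>E `` {v}. (#) u ` walks E r v u)"
  have Xn: "nbw E (v # p) \<and> length p = Suc r" if "p \<in> X" for p
    using that by (auto simp: X_def walks_def)
  have "(\<Sum>u\<in>E `` {v}. card (walks E r v u)) = card X"
    unfolding X_def using fE
    by (subst card_UN_disjoint) (auto simp: card_image intro: finite_imageI finite_walks)
  also have "\<dots> \<le> card (S - {v})"
  proof (rule card_inj_on_le)
    show "inj_on (\<lambda>p. last (v # p)) X"
      by (rule inj_onI, rule nbw_last_inj[OF assms(3-5)]) (use Xn assms(6) in auto)
    show "(\<lambda>p. last (v # p)) ` X \<subseteq> S - {v}"
    proof clarify
      fix p assume p: "p \<in> X"
      then obtain u q where q: "p = u # q" by (auto simp: X_def)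
      have "last (v # p) \<in> set (v # u # q)" using q by (metis last_in_set list.distinct(1))
      then have "last (v # p) \<in> S" using nbw_subset[OF assms(2), of v u q] Xn[OF p] q by auto
      moreover have "last (v # p) \<noteq> v"
      proof
        assume "last (v # p) = v"
        then have "p = []"
          using Xn[OF p] assms(6) by (intro nbw_last_inj[OF assms(3-5), of v]) auto
        with q show False by simp
      qed
      ultimately show "last (v # p) \<in> S - {v}" by simp
    qed
  qed (use assms(1) in simp)
  also have "\<dots> = card S - 1" using assms(1,7) by simp
  finally show ?thesis .
qed

text \<open>The walks behind the two ends of an edge reach disjoint sets of vertices, and
  \<open>v\<close> lies in neither of them.\<close>

lemma sum_walks_arc_le:
  assumes "finite S" "E \<subseteq> S \<times> S" "irrefl E" "sym E" "girth_ge g E" "2 * r + 1 < g" "0 < r"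
    and uv: "(u, v) \<in> E"
  shows "card (walks E r u v) + card (walks E r v u) \<le> card S - 1"
proof -
  have fE: "finite E" using assms(1,2) finite_subset by blast
  have vu: "(v, u) \<in> E" using uv assms(4) by (auto dest: symD)
  have S: "u \<in> S" "v \<in> S" using uv assms(2) by auto
  let ?W = "\<lambda>u v. (\<lambda>p. last (v # p)) ` walks E r u v"
  have card: "card (?W x y) = card (walks E r x y)" for x y
    by (rule card_image, rule inj_onI, rule nbw_last_inj[OF assms(3-5), of y])
      (use assms(6) in \<open>auto simp: walks_def dest: nbw_ConsD\<close>)
  have sub: "?W x y \<subseteq> S" for x y
  proof clarify
    fix p assume "p \<in> walks E r x y"
    then have "set (x # y # p) \<subseteq> S" by (intro nbw_subset[OF assms(2)]) (simp add: walks_def)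
    moreover have "last (y # p) \<in> set (y # p)" by (rule last_in_set) simp
    ultimately show "last (y # p) \<in> S" by auto
  qed
  have vW: "v \<notin> ?W u v"
  proof
    assume "v \<in> ?W u v"
    then obtain p where p: "length p = r" "nbw E (u # v # p)" "v = last (v # p)"
      by (auto simp: walks_def)
    have "p = []"
      by (rule nbw_last_inj[OF assms(3-5), of v]) (use p assms(6) nbw_ConsD in auto)
    with p assms(7) show False by simp
  qed
  have disj: "w \<notin> ?W v u" if w: "w \<in> insert v (?W u v)" for w
  proof
    assume "w \<in> ?W v u"
    then obtain q where q: "length q = r" "nbw E (v # u # q)" "w = last (u # q)"
      by (auto simp: walks_def)
    \<comment> \<open>The vertex \<open>v\<close> is treated as the end of the empty continuation,
      so one uniqueness argument covers both cases.\<close>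
    have "w = v \<or> (\<exists>p. length p = r \<and> nbw E (u # v # p) \<and> w = last (v # p))"
      using w by (auto simp: walks_def)
    then obtain p where p: "length p \<le> r" "nbw E (u # v # p)" "w = last (v # p)"
      using uv by (metis last.simps le0 le_refl list.size(3) nbw.simps(3))
    have "p = u # q"
      by (rule nbw_last_inj[OF assms(3-5), of v]) (use p q assms(6) nbw_ConsD in auto)
    with p q show False by simp
  qed
  have fin: "finite (?W x y)" for x y using finite_walks[OF fE] by simp
  have "card (walks E r u v) + card (walks E r v u) + 1
      = card (insert v (?W u v)) + card (?W v u)"
    unfolding card_insert_disjoint[OF fin vW] card by simp
  also have "\<dots> = card (insert v (?W u v) \<union> ?W v u)"
    by (rule card_Un_disjoint[symmetric]) (use fin disj in blast)+
  also have "\<dots> \<le> card S" by (rule card_mono[OF assms(1)]) (use sub S in auto)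
  finally show ?thesis by simp
qed

text \<open>The lower bound on the number of walks meets the upper bound. For \<open>c = 1\<close>
  the walks have \<open>t\<close> arcs in total and are grouped by their first vertex. For
  \<open>c = 2\<close> they have \<open>t\<close> arcs behind the initial one, and opposite initial
  arcs are paired: the two share one set of ends, hence the factor 2.\<close>

lemma moore_min_degree_two:
  fixes c :: nat
  assumes "finite S" "S \<noteq> {}" "E \<subseteq> S \<times> S" "irrefl E" "sym E" "girth_ge g E" "0 < t"
    and c: "c = 1 \<and> 2 * t < g \<or> c = 2 \<and> 2 * t + 1 < g"
    and deg: "\<And>v. v \<in> S \<Longrightarrow> 2 \<le> card (E `` {v})"
  shows "c * (card E / card S - 1) ^ t < card S"
proof -
  let ?M = "real (card E)" and ?N = "real (card S)"
  let ?q = "?M / ?N - 1"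
  have N: "1 \<le> card S" using assms(1,2) by (simp add: Suc_le_eq card_gt_0_iff)
  have M: "card E = (\<Sum>v\<in>S. card (E `` {v}))" using card_arcs[OF assms(1,3)] by simp
  have "2 * card S \<le> card E" unfolding M using sum_mono[of S "\<lambda>_. 2" "\<lambda>v. card (E `` {v})"] deg
    by (simp add: mult.commute)
  then have "2 * ?N \<le> ?M" by linarith
  then have q: "1 \<le> ?q" using N by (auto simp: field_simps)
  from c show ?thesis
  proof
    assume c1: "c = 1 \<and> 2 * t < g"
    obtain r where r: "t = Suc r" using assms(7) gr0_conv_Suc by auto
    have "?M * ?q ^ r \<le> (\<Sum>v\<in>S. \<Sum>u\<in>E `` {v}. real (card (walks E r u v)))"
      by (rule sum_walks_ge[OF assms(1-3,5) deg])
    also have "\<dots> = (\<Sum>v\<in>S. \<Sum>u\<in>E `` {v}. real (card (walks E r v u)))"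
      by (rule sum_arcs_swap[OF assms(1,3,5)])
    also have "\<dots> \<le> (\<Sum>v\<in>S. ?N - 1)"
    proof (rule sum_mono)
      fix v assume "v \<in> S"
      then have "(\<Sum>u\<in>E `` {v}. card (walks E r v u)) \<le> card S - 1"
        using c1 r by (intro sum_walks_vertex_le[OF assms(1,3-6)]) auto
      then have "real (\<Sum>u\<in>E `` {v}. card (walks E r v u)) \<le> real (card S - 1)"
        by (rule of_nat_mono)
      then show "(\<Sum>u\<in>E `` {v}. real (card (walks E r v u))) \<le> ?N - 1"
        using N by (simp add: of_nat_diff)
    qed
    finally have "?M / ?N * ?q ^ r \<le> ?N - 1" using N by (simp add: field_simps)
    \<comment> \<open>The first step of a walk has all d neighbours to choose from and not d - 1;
      replacing d by d - 1 makes up the power \<open>t\<close>.\<close>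
    moreover have "?q * ?q ^ r \<le> ?M / ?N * ?q ^ r" using q by (intro mult_right_mono) auto
    ultimately show ?thesis using c1 r by simp
  next
    assume c2: "c = 2 \<and> 2 * t + 1 < g"
    let ?W = "\<Sum>v\<in>S. \<Sum>u\<in>E `` {v}. real (card (walks E t u v))"
    have "2 * ?W = ?W + (\<Sum>v\<in>S. \<Sum>u\<in>E `` {v}. real (card (walks E t v u)))"
      using sum_arcs_swap[OF assms(1,3,5), of "\<lambda>u v. real (card (walks E t u v))"] by simp
    also have "\<dots> = (\<Sum>v\<in>S. \<Sum>u\<in>E `` {v}. real (card (walks E t u v) + card (walks E t v u)))"
      by (simp add: sum.distrib)
    also have "\<dots> \<le> (\<Sum>v\<in>S. \<Sum>u\<in>E `` {v}. ?N - 1)"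
    proof (intro sum_mono)
      fix v u assume "u \<in> E `` {v}"
      then have "card (walks E t u v) + card (walks E t v u) \<le> card S - 1"
        using c2 assms(5,7) by (intro sum_walks_arc_le[OF assms(1,3-6)]) (auto dest: symD)
      then have "real (card (walks E t u v) + card (walks E t v u)) \<le> real (card S - 1)"
        by (rule of_nat_mono)
      then show "real (card (walks E t u v) + card (walks E t v u)) \<le> ?N - 1"
        using N by (simp add: of_nat_diff)
    qed
    also have "\<dots> = ?M * (?N - 1)" by (simp add: M sum_distrib_right)
    finally have "2 * (?M * ?q ^ t) \<le> ?M * (?N - 1)"
      using sum_walks_ge[OF assms(1-3,5) deg, of t] by linarith
    then have "2 * ?q ^ t \<le> ?N - 1"
      using \<open>2 * ?N \<le> ?M\<close> N by (auto simp: mult.left_commute[of 2])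
    then show ?thesis using c2 by simp
  qed
qed

text \<open>A vertex with at most one neighbour takes at most two arcs with it, so deleting it does
  not lower an average that is at least 2. The deletion ends at minimum degree 2.\<close>

lemma moore_average_two:
  fixes c :: nat
  assumes "finite S" "S \<noteq> {}" "E \<subseteq> S \<times> S" "irrefl E" "sym E" "girth_ge g E" "0 < t"
    and c: "c = 1 \<and> 2 * t < g \<or> c = 2 \<and> 2 * t + 1 < g"
    and avg: "2 * card S \<le> card E"
  shows "c * (card E / card S - 1) ^ t < card S"
  using assms(1-6,9)
proof (induction "card S" arbitrary: S E rule: less_induct)
  case less
  note prems = less.prems
  show ?case
  proof (cases "\<forall>v\<in>S. 2 \<le> card (E `` {v})")
    case True
    then show ?thesis
      using moore_min_degree_two[OF prems(1-6) assms(7) c] by blast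
  next
    case False
    then obtain v where v: "v \<in> S" "card (E `` {v}) < 2" by force
    have fE: "finite E" using prems(1,3) finite_subset by blast
    let ?S = "S - {v}" and ?E = "E \<inter> (S - {v}) \<times> (S - {v})"
    have "E \<subseteq> ?E \<union> ({v} \<times> E `` {v} \<union> E `` {v} \<times> {v})"
      using prems(3,5) by (auto dest: symD)
    then have "card E \<le> card (?E \<union> ({v} \<times> E `` {v} \<union> E `` {v} \<times> {v}))"
      using fE by (intro card_mono) auto
    also have "\<dots> \<le> card ?E + (card ({v} \<times> E `` {v}) + card (E `` {v} \<times> {v}))"
      by (meson add_left_mono card_Un_le le_trans)
    also have "\<dots> \<le> card ?E + 2" using v(2) by (simp add: card_cartesian_product)
    finally have E: "card E \<le> card ?E + 2" .
    have cS: "card S = card ?S + 1" using v(1) prems(1) by (metis Suc_eq_plus1 card_Suc_Diff1)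
    \<comment> \<open>A single vertex has no arcs and hence no average degree of 2.\<close>
    have "?S \<noteq> {}"
    proof
      assume "?S = {}"
      then have "E \<subseteq> {(v, v)}" using prems(3) by auto
      then have "E = {}" using prems(4) by (auto simp: irrefl_def)
      with prems(7) cS show False by simp
    qed
    moreover have "girth_ge g ?E" using prems(6) by (rule girth_ge_subset) auto
    ultimately have "c * (card ?E / card ?S - 1) ^ t < card ?S"
      using prems cS E
      by (intro less.hyps) (auto simp: irrefl_def sym_def)
    moreover have "card E / card S - 1 \<le> card ?E / card ?S - 1"
    proof -
      have N: "0 < card ?S" using \<open>?S \<noteq> {}\<close> prems(1) by (simp add: card_gt_0_iff)
      have "card E * card ?S \<le> (card ?E + 2) * card ?S" using E by (rule mult_right_mono) simp
      also have "\<dots> \<le> card ?E * card S"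
      proof -
        have "2 * card ?S \<le> card ?E" using prems(7) cS E by linarith
        then show ?thesis unfolding cS by simp
      qed
      finally have "real (card E) * card ?S \<le> real (card ?E) * card S"
        by (metis of_nat_le_iff of_nat_mult)
      then show ?thesis using N cS by (simp add: field_simps)
    qed
    moreover have "0 \<le> card E / card S - 1"
      using prems(7) cS by (simp add: field_simps)
    ultimately have "c * (card E / card S - 1) ^ t < card ?S"
      by (smt (verit) mult_left_mono of_nat_0_le_iff power_mono)
    then show ?thesis using cS by simp
  qed
qed

text \<open>From average degree 2 on, this is the \<open>t\<close>-th root of the Moore bound. Below
  it, the right-hand side is at least \<open>2 * card S\<close> as soon as
  \<open>c \<le> card S\<close>.\<close>

lemma card_arcs_less:
  fixes c t :: nat
  assumes "finite S" "S \<noteq> {}" "E \<subseteq> S \<times> S" "irrefl E" "sym E" "girth_ge g E" "0 < t"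
    and c: "c = 1 \<and> 2 * t < g \<or> c = 2 \<and> 2 * t + 1 < g"
  shows "real (card E) < card S + card S * (card S / c) powr (1 / t)"
proof (cases "2 * card S \<le> card E")
  case True
  let ?N = "real (card S)" and ?q = "card E / card S - 1"
  have N: "0 < ?N" using assms(1,2) by (simp add: card_gt_0_iff)
  have c0: "0 < real c" using c by auto
  have q: "0 < ?q" using True N by (simp add: field_simps)
  have "?q ^ t < ?N / c"
    using moore_average_two[OF assms True] c0 by (simp add: field_simps)
  then have "(?q ^ t) powr (1 / t) < (?N / c) powr (1 / t)"
    using q assms(7) by (intro powr_less_mono2) auto
  moreover have "(?q ^ t) powr (1 / t) = ?q"
    using q assms(7) by (simp add: powr_powr flip: powr_realpow)
  ultimately have "?N * ?q < ?N * (?N / c) powr (1 / t)" using N by simp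
  moreover have "?N * ?q = card E - ?N" using N by (simp add: field_simps)
  ultimately show ?thesis by linarith
next
  case False
  have N: "0 < card S" using assms(1,2) by (simp add: card_gt_0_iff)
  show ?thesis
  proof (cases "c \<le> card S")
    case True
    have "1 \<le> (card S / c) powr (1 / t)"
      using True c by (intro ge_one_powr_ge_zero) auto
    then have "real (card S) * 1 \<le> card S * (card S / c) powr (1 / t)"
      by (intro mult_left_mono) auto
    with False show ?thesis by linarith
  next
    \<comment> \<open>Here \<open>c = 2\<close> and the root is below 1, but a single vertex carries
      no arcs.\<close>
    case F: False
    then have "card S = 1" using N c by auto
    then obtain v where "S = {v}" by (auto simp: card_1_singleton_iff)
    then have "E = {}" using assms(3,4) by (auto simp: irrefl_def)
    then show ?thesis using N by (simp add: add_pos_nonneg)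
  qed
qed

section \<open>Quadratic forms and the signless Laplacian\<close>

text \<open>The first-order condition at a maximum: for small \<open>s\<close> of the sign of
  \<open>b\<close> the linear term wins.\<close>

lemma linear_coefficient_eq_0:
  fixes b c :: real
  assumes "\<And>s. 2 * s * b \<le> s\<^sup>2 * c"
  shows "b = 0"
proof (rule ccontr)
  assume b: "b \<noteq> 0"
  define m where "m = \<bar>c\<bar> + 1"
  have m: "0 < m" "c < m" by (auto simp: m_def)
  have "2 * (b / m) * b \<le> (b / m)\<^sup>2 * c" by (rule assms)
  then have "2 * b\<^sup>2 * m \<le> b\<^sup>2 * c"
    using m by (simp add: power2_eq_square field_simps)
  then have "2 * m \<le> c" using b by (simp add: mult.left_commute mult.assoc)
  with m show False by linarith
qed

text \<open>The maximum of the quadratic form on the unit sphere is an eigenvalue, because the form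
  is stationary at a maximizer in every coordinate direction.\<close>

lemma symmetric_form_max_eigenvector:
  fixes a :: "nat \<Rightarrow> nat \<Rightarrow> real"
  assumes "0 < n" and sym: "\<And>i j. i < n \<Longrightarrow> j < n \<Longrightarrow> a i j = a j i"
  obtains x l where "\<exists>i<n. x i \<noteq> 0" "\<And>i. i < n \<Longrightarrow> (\<Sum>j<n. a i j * x j) = l * x i"
    "\<And>y. (\<Sum>i<n. \<Sum>j<n. a i j * y i * y j) \<le> l * (\<Sum>i<n. (y i)\<^sup>2)"
proof -
  define q where "q x = (\<Sum>i<n. \<Sum>j<n. a i j * x i * x j)" for x :: "nat \<Rightarrow> real"
  define N where "N x = (\<Sum>i<n. (x i)\<^sup>2)" for x :: "nat \<Rightarrow> real"
  \<comment> \<open>Vectors are functions on all of \<open>nat\<close>; fixing the coordinates from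
    \<open>n\<close> on to 0 makes \<open>B\<close> a product of compact sets, so that Tychonoff's
    theorem applies.\<close>
  define B where "B = Pi\<^sub>E UNIV (\<lambda>i. if i < n then {-1..1::real} else {0})"
  define K where "K = B \<inter> {x. N x = 1}"
  have "compactin (product_topology (\<lambda>_. euclidean) UNIV) B"
    unfolding B_def by (subst compactin_PiE) auto
  then have "compact B"
    by (simp add: euclidean_product_topology)
  moreover have "closed {x. N x = 1}"
    unfolding N_def
    by (intro closed_Collect_eq continuous_intros continuous_on_product_coordinates)
  ultimately have "compact K" unfolding K_def by (rule compact_Int_closed)
  have unit: "(\<lambda>i. if i < n then y i / sqrt (N y) else 0) \<in> K"
    and q_unit: "q (\<lambda>i. if i < n then y i / sqrt (N y) else 0) = q y / N y"
    if "0 < N y" for y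
  proof -
    have "\<bar>y i\<bar> \<le> sqrt (N y)" if "i < n" for i
    proof -
      have "(y i)\<^sup>2 \<le> N y" unfolding N_def using that by (intro member_le_sum) auto
      then show ?thesis using real_sqrt_le_mono by fastforce
    qed
    then have "y i / sqrt (N y) \<in> {-1..1}" if "i < n" for i
      using that \<open>0 < N y\<close> by (force simp: abs_le_iff field_simps)
    moreover have "(\<Sum>i<n. (if i < n then y i / sqrt (N y) else 0)\<^sup>2) = (\<Sum>i<n. (y i)\<^sup>2 / N y)"
      using that by (intro sum.cong) (auto simp: power_divide)
    moreover have "\<dots> = 1" using that by (simp add: N_def flip: sum_divide_distrib)
    ultimately show "(\<lambda>i. if i < n then y i / sqrt (N y) else 0) \<in> K"
      by (auto simp: K_def B_def N_def)
    have "q (\<lambda>i. if i < n then y i / sqrt (N y) else 0) = (\<Sum>i<n. \<Sum>j<n. a i j * y i * y j / N y)"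
      unfolding q_def using that by (intro sum.cong refl) (auto simp: mult.assoc)
    then show "q (\<lambda>i. if i < n then y i / sqrt (N y) else 0) = q y / N y"
      by (simp add: q_def sum_divide_distrib)
  qed
  have "N (\<lambda>_. 1) = n" by (simp add: N_def)
  then have "K \<noteq> {}" using unit[of "\<lambda>_. 1"] assms(1) by auto
  moreover have "continuous_on K q"
    unfolding q_def
    by (intro continuous_intros continuous_on_subset[OF continuous_on_product_coordinates]) auto
  ultimately obtain x where x: "x \<in> K" and xmax: "\<And>y. y \<in> K \<Longrightarrow> q y \<le> q x"
    using continuous_attains_sup[OF \<open>compact K\<close>] by blast
  have Nx: "N x = 1" using x by (simp add: K_def)
  have max: "q y \<le> q x * N y" for y
  proof (cases "N y = 0")
    case True
    then have "y i = 0" if "i < n" for i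
      using that sum_nonneg_eq_0_iff[of "{..<n}" "\<lambda>i. (y i)\<^sup>2"] by (simp add: N_def)
    then have "q y = 0" by (simp add: q_def)
    with True show ?thesis by simp
  next
    case False
    then have "0 < N y" using sum_nonneg[of "{..<n}" "\<lambda>i. (y i)\<^sup>2"] by (simp add: N_def)
    with xmax[OF unit] q_unit show ?thesis by (simp add: field_simps)
  qed
  show thesis
  proof
    show "\<exists>i<n. x i \<noteq> 0" using Nx by (auto simp: N_def intro: ccontr)
    show "(\<Sum>i<n. \<Sum>j<n. a i j * y i * y j) \<le> q x * (\<Sum>i<n. (y i)\<^sup>2)" for y
      using max by (simp add: q_def N_def)
    show "(\<Sum>j<n. a k j * x j) = q x * x k" if k: "k < n" for k
    proof -
      define e where "e i = (if i = k then 1 else 0::real)" for i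
      let ?r = "\<Sum>j<n. a k j * x j"
      have e1: "(\<Sum>i<n. f i * e i) = f k" for f
        unfolding e_def using k by (simp add: sum.delta if_distrib cong: if_cong)
      have r2: "(\<Sum>i<n. a i k * x i) = ?r" using sym k by (intro sum.cong) auto
      \<comment> \<open>This is maximality tested at \<open>x + s * e\<close>: as
        \<open>N x = 1\<close>, the constant terms of both sides cancel.\<close>
      have "2 * s * (?r - q x * x k) \<le> s\<^sup>2 * (q x - a k k)" for s
      proof -
        have "q (\<lambda>i. x i + s * e i) = q x + s * (\<Sum>i<n. \<Sum>j<n. a i j * x i * e j)
            + s * (\<Sum>i<n. \<Sum>j<n. a i j * x j * e i) + s\<^sup>2 * (\<Sum>i<n. \<Sum>j<n. a i j * e i * e j)"
          unfolding q_def
          by (simp add: sum.distrib sum_distrib_left algebra_simps power2_eq_square)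
        also have "(\<Sum>i<n. \<Sum>j<n. a i j * x i * e j) = ?r"
          by (simp add: e1 r2)
        also have "(\<Sum>i<n. \<Sum>j<n. a i j * x j * e i) = ?r"
          by (simp add: e1 flip: sum_distrib_right)
        also have "(\<Sum>i<n. \<Sum>j<n. a i j * e i * e j) = a k k"
          by (simp add: e1)
        finally have "q (\<lambda>i. x i + s * e i) = q x + 2 * s * ?r + s\<^sup>2 * a k k" by simp
        moreover have "N (\<lambda>i. x i + s * e i) = N x + 2 * s * x k + s\<^sup>2"
        proof -
          have "N (\<lambda>i. x i + s * e i)
              = N x + 2 * s * (\<Sum>i<n. x i * e i) + s\<^sup>2 * (\<Sum>i<n. e i * e i)"
            unfolding N_def
            by (simp add: sum.distrib sum_distrib_left algebra_simps power2_eq_square)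
          then show ?thesis using e1[of x] e1[of e] by (simp add: e_def)
        qed
        ultimately show ?thesis
          using max[of "\<lambda>i. x i + s * e i"] Nx by (simp add: algebra_simps)
      qed
      then have "?r - q x * x k = 0" by (rule linear_coefficient_eq_0)
      then show ?thesis by simp
    qed
  qed
qed

lemma symmetric_mat_Max_spectrum_ge:
  fixes A :: "real mat"
  assumes A: "A \<in> carrier_mat n n" and "0 < n"
    and "\<And>i j. i < n \<Longrightarrow> j < n \<Longrightarrow> A $$ (i, j) = A $$ (j, i)"
  shows "(\<Sum>i<n. \<Sum>j<n. A $$ (i, j)) \<le> Max (spectrum A) * n"
proof -
  obtain x l where x: "\<exists>i<n. x i \<noteq> 0" "\<And>i. i < n \<Longrightarrow> (\<Sum>j<n. A $$ (i, j) * x j) = l * x i"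
    and l: "\<And>y. (\<Sum>i<n. \<Sum>j<n. A $$ (i, j) * y i * y j) \<le> l * (\<Sum>i<n. (y i)\<^sup>2)"
    using symmetric_form_max_eigenvector[of n "\<lambda>i j. A $$ (i, j)", OF assms(2,3)] by blast
  have "Matrix.vec n x \<noteq> 0\<^sub>v n"
    using x(1) by (auto simp: vec_eq_iff)
  moreover have "A *\<^sub>v Matrix.vec n x = l \<cdot>\<^sub>v Matrix.vec n x"
    by (rule eq_vecI) (use A x(2) in \<open>auto simp: scalar_prod_def atLeast0LessThan\<close>)
  ultimately have "l \<in> spectrum A"
    unfolding spectrum_def eigenvalue_def eigenvector_def using A
    by (intro CollectI exI[of _ "Matrix.vec n x"]) simp
  then have "l \<le> Max (spectrum A)" using card_finite_spectrum(1)[OF A] by (rule Max_ge[rotated])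
  then have "l * n \<le> Max (spectrum A) * n" by (rule mult_right_mono) simp
  with l[of "\<lambda>_. 1"] show ?thesis by simp
qed

text \<open>Every row of the signless Laplacian sums to twice the degree, so the all-ones vector has
  Rayleigh quotient twice the average degree.\<close>

lemma Q_index_ge_average:
  fixes H :: "'a pair_pre_digraph"
  assumes "finite (pverts H)" "pverts H \<noteq> {}" "parcs H \<subseteq> pverts H \<times> pverts H" "sym (parcs H)"
  shows "2 * real (card (parcs H)) \<le> Q_index (with_proj H) * card (pverts H)"
proof -
  let ?V = "pverts H" and ?E = "parcs H"
  define vs where "vs = vertex_enum (with_proj H)"
  have "\<exists>vs. distinct vs \<and> set vs = ?V" using finite_distinct_list[OF assms(1)] by auto
  then have vs: "distinct vs" "set vs = ?V"
    using someI_ex[of "\<lambda>vs. distinct vs \<and> set vs = ?V"] by (auto simp: vs_def vertex_enum_def)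
  define n where "n = length vs"
  have n: "card ?V = n" using vs distinct_card[of vs] by (simp add: n_def)
  define A where "A = signless_laplacian (with_proj H) vs"
  have A: "A \<in> carrier_mat n n"
    by (simp add: A_def signless_laplacian_def degree_mat_def adjacency_mat_def n_def)
  have entry: "A $$ (i, j) = (if i = j then real (card (?E `` {vs ! i})) else 0)
      + (if (vs ! i, vs ! j) \<in> ?E then 1 else 0)" if "i < n" "j < n" for i j
  proof -
    have "out_arcs (with_proj H) (vs ! i) = Pair (vs ! i) ` (?E `` {vs ! i})"
      by (auto simp: out_arcs_def)
    then have "out_degree (with_proj H) (vs ! i) = card (?E `` {vs ! i})"
      by (simp add: out_degree_def card_image inj_on_def)
    moreover have "arcs_ends (with_proj H) = ?E"
      by (auto simp: arcs_ends_def arc_to_ends_def)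
    ultimately show ?thesis
      using that
      by (cases "i = j")
        (simp_all add: A_def signless_laplacian_def degree_mat_def adjacency_mat_def n_def)
  qed
  have bij: "bij_betw ((!) vs) {..<n} ?V"
    using vs by (auto simp: n_def intro: bij_betw_nth)
  have sums: "(\<Sum>i<n. f (vs ! i)) = (\<Sum>v\<in>?V. f v)" for f :: "'a \<Rightarrow> real"
    by (rule sum.reindex_bij_betw[OF bij])
  have "(\<Sum>j<n. A $$ (i, j)) = 2 * real (card (?E `` {vs ! i}))" if i: "i < n" for i
  proof -
    have "(\<Sum>j<n. A $$ (i, j)) = (\<Sum>j<n. if i = j then real (card (?E `` {vs ! i})) else 0)
        + (\<Sum>j<n. if (vs ! i, vs ! j) \<in> ?E then 1 else 0)"
      using entry i by (simp add: sum.distrib)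
    also have "(\<Sum>j<n. if i = j then real (card (?E `` {vs ! i})) else 0)
        = card (?E `` {vs ! i})" using i by simp
    also have "(\<Sum>j<n. if (vs ! i, vs ! j) \<in> ?E then 1 else 0)
        = (\<Sum>v\<in>?V. if (vs ! i, v) \<in> ?E then 1 else 0 :: real)"
      by (rule sums)
    also have "\<dots> = card {v \<in> ?V. (vs ! i, v) \<in> ?E}"
      using assms(1) by (simp add: sum.If_cases Int_def)
    also have "{v \<in> ?V. (vs ! i, v) \<in> ?E} = ?E `` {vs ! i}" using assms(3) by auto
    finally show ?thesis by simp
  qed
  then have "(\<Sum>i<n. \<Sum>j<n. A $$ (i, j)) = (\<Sum>i<n. 2 * real (card (?E `` {vs ! i})))"
    by simp
  also have "\<dots> = 2 * real (card ?E)"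
    unfolding sums[of "\<lambda>v. 2 * real (card (?E `` {v}))"]
    using card_arcs[OF assms(1,3)] by (simp flip: sum_distrib_left)
  finally have "2 * real (card ?E) = (\<Sum>i<n. \<Sum>j<n. A $$ (i, j))" by simp
  also have "\<dots> \<le> Max (spectrum A) * n"
  proof (rule symmetric_mat_Max_spectrum_ge[OF A])
    show "0 < n" using n assms(1,2) by (metis card_gt_0_iff)
    show "A $$ (i, j) = A $$ (j, i)" if "i < n" "j < n" for i j
      using entry that assms(4) by (auto simp: sym_def)
  qed
  finally show ?thesis by (simp add: Q_index_def A_def vs_def n)
qed

section \<open>Majorization for powers\<close>

lemma powr_convex_on:
  fixes p :: real
  assumes "1 \<le> p"
  shows "convex_on {0<..} (\<lambda>x. x powr p)"
proof (rule f''_ge0_imp_convex)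
  fix x :: real assume "x \<in> {0<..}"
  then have x: "0 < x" by simp
  show "((\<lambda>x. x powr p) has_real_derivative p * x powr (p - 1)) (at x)"
    using x by (auto intro!: derivative_eq_intros)
  show "((\<lambda>x. p * x powr (p - 1)) has_real_derivative p * ((p - 1) * x powr (p - 1 - 1))) (at x)"
    using x by (auto intro!: derivative_eq_intros)
  show "0 \<le> p * ((p - 1) * x powr (p - 1 - 1))" using assms by simp
qed simp

text \<open>The pair \<open>(x, y)\<close> is weakly majorized by \<open>(l, m)\<close>.\<close>

lemma sum_powr_le:
  fixes p x y l m :: real
  assumes "1 \<le> p" "0 < x" "0 < y" "0 < l" "0 < m" "x \<le> m" "y \<le> m" "x + y \<le> l + m"
  shows "x powr p + y powr p \<le> l powr p + m powr p"
proof -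
  have mono: "a powr p \<le> b powr p" if "0 < a" "a \<le> b" for a b
    using that assms(1) by (intro powr_mono2) auto
  consider "y \<le> l" | "x \<le> l" | "l < y" "l < x" by linarith
  then show ?thesis
  proof cases
    case 1
    with mono[of y l] mono[of x m] assms show ?thesis by linarith
  next
    case 2
    with mono[of x l] mono[of y m] assms show ?thesis by linarith
  next
    case 3
    \<comment> \<open>The larger partner \<open>z \<ge> x\<close> makes the sums equal. Then
      \<open>y\<close> and \<open>z\<close> lie symmetrically between \<open>l\<close> and
      \<open>m\<close>, with weights \<open>s\<close> and \<open>1 - s\<close>, and the two
      convexity bounds add up without remainder.\<close>
    define z where "z = l + m - y"
    have z: "x \<le> z" "l \<le> z" "z \<le> m" "l < m" using 3 assms by (auto simp: z_def)
    define s where "s = (y - l) / (m - l)"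
    have s: "0 \<le> s" "s \<le> 1" using 3 assms z by (auto simp: s_def field_simps)
    have "s * (m - l) = y - l" using z by (simp add: s_def)
    then have y: "y = (1 - s) * l + s * m" and zz: "z = (1 - (1 - s)) * l + (1 - s) * m"
      unfolding z_def by (simp_all add: algebra_simps)
    have conv: "((1 - r) * l + r * m) powr p \<le> (1 - r) * l powr p + r * m powr p"
      if "0 \<le> r" "r \<le> 1" for r
      using convex_onD[OF powr_convex_on[OF assms(1)], of r l m] that assms by simp
    have "y powr p + z powr p \<le> ((1 - s) * l powr p + s * m powr p)
        + ((1 - (1 - s)) * l powr p + (1 - s) * m powr p)"
      using conv[of s] conv[of "1 - s"] s unfolding y[symmetric] zz[symmetric] by linarith
    also have "\<dots> = l powr p + m powr p" by (simp add: algebra_simps)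
    finally show ?thesis using mono[of x z] z assms by linarith
  qed
qed

section \<open>Vertex cuts and the complement\<close>

lemma nu_le_card_region:
  assumes "finite V" "E \<subseteq> V \<times> V" "irrefl E" "sym E" "girth_ge g E" "3 \<le> g"
    and deg: "\<And>v. v \<in> V \<Longrightarrow> \<delta> \<le> card (E `` {v})"
    and region: "\<And>a b. a \<in> A \<Longrightarrow> (a, b) \<in> E \<Longrightarrow> b \<in> A \<union> C"
    and A: "A \<subseteq> V" "A \<noteq> {}" and C: "finite C" "card C \<le> \<kappa>" "\<kappa> < \<delta>" "2 \<le> \<delta>"
  shows "nu \<delta> g \<kappa> \<le> int (card A)"
proof -
  define t where "t = (g - 1) div 2"
  have fA: "finite A" and fE: "finite E" using assms(1,2) A(1) finite_subset by blast+
  have deg': "\<delta> \<le> card (E `` {x})" if "(x, y) \<in> E" for x y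
    using that deg assms(2) by auto
  have pow: "(\<Sum>i<t. (int \<delta> - 1) ^ i) = int (\<Sum>i<t. (\<delta> - 1) ^ i)"
    using C(4) by (simp add: of_nat_diff)
  obtain u where u: "u \<in> A" using A by auto
  then have du: "\<delta> \<le> card (E `` {u})" using deg A by auto
  consider "g = 2 * t + 1" | "g = 2 * t + 2" "3 \<le> \<delta>" | "g = 2 * t + 2" "\<delta> = 2"
    unfolding t_def using assms(6) C(4) by linarith
  then show ?thesis
  proof cases
    case 1
    then have "1 + (\<delta> - \<kappa>) * (\<Sum>i<t. (\<delta> - 1) ^ i) \<le> card A"
      by (intro region_card_odd[OF fA C(1) fE assms(3-5) _ deg' region u du C(2)]) auto
    then have "int (1 + (\<delta> - \<kappa>) * (\<Sum>i<t. (\<delta> - 1) ^ i)) \<le> int (card A)" by (rule of_nat_mono)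
    moreover have "int (\<delta> - \<kappa>) = int \<delta> - int \<kappa>" using C(3) by simp
    ultimately show ?thesis
      using 1 unfolding nu_def Let_def t_def[symmetric] pow by simp
  next
    case 2
    \<comment> \<open>The tree needs an edge inside \<open>A\<close>; it exists because
      \<open>u\<close> has more neighbours than \<open>C\<close> has vertices.\<close>
    have "\<not> E `` {u} \<subseteq> C" using card_mono[OF C(1), of "E `` {u}"] du C by linarith
    then obtain v where v: "(u, v) \<in> E" "v \<in> A" using region u by blast
    have "2 + (2 * \<delta> - 2 - \<kappa>) * (\<Sum>i<t. (\<delta> - 1) ^ i) \<le> card A"
      using 2 by (intro region_card_even[OF fA C(1) fE assms(3-5) _ deg' region u v(2,1) C(2)]) auto
    then have "int (2 + (2 * \<delta> - 2 - \<kappa>) * (\<Sum>i<t. (\<delta> - 1) ^ i)) \<le> int (card A)"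
      by (rule of_nat_mono)
    moreover have "int (2 * \<delta> - 2 - \<kappa>) = 2 * int \<delta> - 2 - int \<kappa>" using C by linarith
    ultimately have "2 + (2 * int \<delta> - 2 - int \<kappa>) * int (\<Sum>i<t. (\<delta> - 1) ^ i) \<le> int (card A)"
      by (simp only: of_nat_add of_nat_mult of_nat_numeral)
    then show ?thesis
      using 2 unfolding nu_def Let_def t_def[symmetric] pow by simp
  next
    case 3
    \<comment> \<open>For \<open>\<kappa> = 1\<close> the tree grown from an edge would give only t
      + 2 vertices; a cycle through the region gives g - 1 = 2t + 1.\<close>
    have "g \<le> card A + 1"
    proof (rule region_card_cycle[OF fA C(1) assms(3-5) _ region A(2)])
      show "2 \<le> card (E `` {x})" if "x \<in> A" for x using that deg A(1) 3 by auto
      show "card C \<le> 1" using C 3 by linarith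
    qed
    then show ?thesis using 3 unfolding nu_def Let_def t_def[symmetric] by simp
  qed
qed

section \<open>Translation from the graph library\<close>

lemma pawalk_zip:
  "pcas u (zip (u # xs) xs) (last (u # xs))" "pawalk_verts u (zip (u # xs) xs) = u # xs"
proof -
  have "pcas u (zip (u # xs) xs) (last (u # xs)) \<and> pawalk_verts u (zip (u # xs) xs) = u # xs"
    by (induction xs arbitrary: u) auto
  then show "pcas u (zip (u # xs) xs) (last (u # xs))" "pawalk_verts u (zip (u # xs) xs) = u # xs"
    by auto
qed

lemma nbw_zip_subset: "nbw E xs \<Longrightarrow> set (zip xs (tl xs)) \<subseteq> E"
  by (induction E xs rule: nbw.induct) auto

lemma girth_ge_parcs:
  assumes "pair_wf_digraph G" "girth (with_proj G) = enat g"
  shows "girth_ge g (parcs G)"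
  unfolding girth_ge_def
proof (intro allI impI)
  interpret pair_wf_digraph G by fact
  fix xs
  assume xs: "distinct xs" "nbw (parcs G) xs" "3 \<le> length xs" "(last xs, hd xs) \<in> parcs G"
  \<comment> \<open>The closing arc comes first, so the tail of the vertex list is \<open>xs\<close>
    itself, and its distinctness is what \<open>cycle\<close> asks for.\<close>
  define p where "p = zip (last xs # xs) xs"
  obtain x ys where cons: "xs = x # ys" using xs(3) by (cases xs) auto
  have "set p \<subseteq> parcs G"
    using nbw_zip_subset[OF xs(2)] xs(4) by (auto simp: p_def cons)
  moreover have "last xs \<in> pverts G" using xs(4) by (rule in_arcsD1)
  moreover have "last (last xs # xs) = last xs" using cons by simp
  ultimately have "awalk (last xs) p (last xs)"
    using pawalk_zip(1)[of "last xs" xs] unfolding awalk_def p_def by simp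
  moreover have "tl (pawalk_verts (last xs) p) = xs"
    unfolding p_def pawalk_zip(2) by simp
  ultimately have "cycle p"
    unfolding cycle_def using xs(1) cons by (auto simp: p_def)
  moreover have "length p = length xs" by (simp add: p_def)
  ultimately have "enat g \<le> enat (length xs)"
    using xs(3) assms(2) unfolding girth_def by (metis (mono_tags, lifting) INF_lower mem_Collect_eq)
  then show "g \<le> length xs" by simp
qed

text \<open>One part is the component of a vertex \<open>u\<close> and the other one is everything
  else, which may itself be disconnected.\<close>

lemma disconnected_induced_parts:
  assumes "pair_wf_digraph G" "W \<noteq> {}" "W \<subseteq> pverts G"
    and "\<not> connected (with_proj G \<restriction> W)"
  obtains A B where "A \<union> B = W" "A \<inter> B = {}" "A \<noteq> {}" "B \<noteq> {}"
    "\<And>a b. a \<in> A \<Longrightarrow> b \<in> B \<Longrightarrow> (a, b) \<notin> parcs G \<and> (b, a) \<notin> parcs G"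
proof -
  define R where "R = parcs (mk_symmetric (with_proj G \<restriction> W))"
  have R: "(a, b) \<in> R" if "a \<in> W" "b \<in> W" "(a, b) \<in> parcs G \<or> (b, a) \<in> parcs G" for a b
    using that unfolding R_def parcs_mk_symmetric by (auto simp: induce_subgraph_def)
  obtain u v where uv: "u \<in> W" "v \<in> W" "(u, v) \<notin> rtrancl_on W R"
    using assms(2,4) unfolding connected_def strongly_connected_def reachable_def R_def by auto
  define A where "A = {w \<in> W. (u, w) \<in> rtrancl_on W R}"
  show thesis
  proof
    show "A \<union> (W - A) = W" "A \<inter> (W - A) = {}" by (auto simp: A_def)
    show "A \<noteq> {}" "W - A \<noteq> {}" using uv by (auto simp: A_def)
    show "(a, b) \<notin> parcs G \<and> (b, a) \<notin> parcs G" if "a \<in> A" "b \<in> W - A" for a b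
      using that R[of a b] rtrancl_on_into_rtrancl_on[of u a W R b] by (auto simp: A_def)
  qed
qed

lemma card_complement_arcs:
  assumes "finite (pverts G)" "parcs G \<subseteq> pverts G \<times> pverts G" "irrefl (parcs G)"
  shows "card (parcs (complement_graph G)) + card (parcs G) + card (pverts G)
    = card (pverts G) * card (pverts G)"
proof -
  let ?V = "pverts G" and ?E = "parcs G" and ?F = "parcs (complement_graph G)"
  have F: "?F \<subseteq> ?V \<times> ?V" by (auto simp: complement_graph_def)
  have fin: "finite ?E" "finite ?F" "finite (Id_on ?V)"
    using assms(1,2) F finite_subset[OF _ finite_cartesian_product[OF assms(1,1)]]
    by (auto simp: Id_on_def)
  have "?V \<times> ?V = ?F \<union> ?E \<union> Id_on ?V"
    using assms(2) by (auto simp: complement_graph_def)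
  then have "card (?V \<times> ?V) = card (?F \<union> ?E \<union> Id_on ?V)" by simp
  also have "\<dots> = card (?F \<union> ?E) + card (Id_on ?V)"
    using fin assms(3) by (intro card_Un_disjoint) (auto simp: complement_graph_def irrefl_def)
  also have "card (?F \<union> ?E) = card ?F + card ?E"
    using fin by (intro card_Un_disjoint) (auto simp: complement_graph_def)
  also have "card (Id_on ?V) = card ?V"
  proof -
    have "Id_on ?V = (\<lambda>v. (v, v)) ` ?V" by auto
    then show ?thesis by (simp add: card_image inj_on_def)
  qed
  finally show ?thesis by (simp add: card_cartesian_product)
qed

text \<open>The minimum in \<open>vertex_connectivity\<close> is attained, since all vertices but
  one always form a cut.\<close>

lemma small_vertex_cut:
  assumes "finite (verts H)" "verts H \<noteq> {}" "\<not> k_connected k H"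
  obtains C where "vertex_cut H C" "card C < k"
proof -
  obtain v where v: "v \<in> verts H" using assms(2) by auto
  have "verts H - (verts H - {v}) = {v}" using v by auto
  then have "vertex_cut H (verts H - {v})" using v by (auto simp: vertex_cut_def)
  then have "card ` {C. vertex_cut H C} \<noteq> {}" by blast
  moreover have "finite {C. vertex_cut H C}"
    by (rule finite_subset[of _ "Pow (verts H)"]) (use assms(1) in \<open>auto simp: vertex_cut_def\<close>)
  ultimately have "vertex_connectivity H \<in> card ` {C. vertex_cut H C}"
    unfolding vertex_connectivity_def by (intro Min_in) auto
  with assms(3) that show thesis by (auto simp: k_connected_def)
qed

text \<open>The parameter \<open>c\<close> merges the two parities of the girth: its root is 1 in
  the odd case.\<close>

lemma Q_index_complement_greater:
  fixes c g k t n :: nat and \<nu> :: real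
  assumes "finite (pverts G)" "parcs G \<subseteq> pverts G \<times> pverts G" "irrefl (parcs G)" "sym (parcs G)"
    and g: "girth_ge g (parcs G)" "0 < t" "c = 1 \<and> 2 * t < g \<or> c = 2 \<and> 2 * t + 1 < g"
    and n: "n = card (pverts G)"
    and parts: "A \<union> B \<union> C = pverts G" "A \<inter> B = {}" "A \<inter> C = {}" "B \<inter> C = {}"
    and sep: "\<And>a b. a \<in> A \<Longrightarrow> b \<in> B \<Longrightarrow> (a, b) \<notin> parcs G \<and> (b, a) \<notin> parcs G"
    and \<nu>: "1 \<le> \<nu>" "\<nu> \<le> card A" "\<nu> \<le> card B" and C: "card C + 1 \<le> k"
  shows "2 * (real n - 1) - 2 / (real n * c powr (1 / t)) * (\<nu> + real k - 1) powr (1 + 1 / t)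
    - 2 / (real n * c powr (1 / t)) * (real n - \<nu>) powr (1 + 1 / t)
    - 2 / real n * (real n + real k - 1) < Q_index (with_proj (complement_graph G))"
proof -
  let ?V = "pverts G" and ?E = "parcs G" and ?p = "1 + 1 / real t"
  define cc where "cc = real c powr (1 / t)"
  define T where "T = ((\<nu> + real k - 1) powr ?p + (real n - \<nu>) powr ?p) / cc"
  have cc: "0 < cc" unfolding cc_def using g(3) by auto
  have fin: "finite A" "finite B" "finite C"
    using assms(1) parts(1) finite_subset by (metis finite_Un)+
  have A0: "A \<noteq> {}" and B0: "B \<noteq> {}" using \<nu> by auto
  define a b where "a = card (A \<union> C)" and "b = card (B \<union> C)"
  have nn: "n = card A + card B + card C"
    unfolding n parts(1)[symmetric] using fin parts by (subst card_Un_disjoint, auto simp: card_Un_disjoint)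
  have a: "a = card A + card C" and b: "b = card B + card C"
    unfolding a_def b_def using fin parts by (auto simp: card_Un_disjoint)
  have part: "real (card (Restr ?E S)) < card S + card S powr ?p / cc"
    if "S = A \<union> C \<or> S = B \<union> C" for S
  proof -
    have S: "finite S" "S \<noteq> {}" using that fin A0 B0 by auto
    have "real (card (Restr ?E S)) < card S + card S * (card S / c) powr (1 / t)"
    proof (rule card_arcs_less[OF S _ _ _ _ g(2,3)])
      show "girth_ge g (Restr ?E S)" using g(1) by (rule girth_ge_subset) auto
      show "irrefl (Restr ?E S)" "sym (Restr ?E S)"
        using assms(3,4) by (auto simp: irrefl_def sym_def)
    qed auto
    also have "card S * (card S / c) powr (1 / t) = card S powr ?p / cc"
      using S g(3) by (simp add: cc_def powr_divide powr_add)
    finally show ?thesis .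
  qed
  \<comment> \<open>No arc joins \<open>A\<close> and \<open>B\<close>; arcs inside \<open>C\<close>
    are counted twice, which is harmless for an upper bound.\<close>
  have "?E \<subseteq> Restr ?E (A \<union> C) \<union> Restr ?E (B \<union> C)"
    using assms(2) sep unfolding parts(1)[symmetric] by blast
  then have "card ?E \<le> card (Restr ?E (A \<union> C) \<union> Restr ?E (B \<union> C))"
    using fin by (intro card_mono) auto
  also have "\<dots> \<le> card (Restr ?E (A \<union> C)) + card (Restr ?E (B \<union> C))" by (rule card_Un_le)
  finally have "real (card ?E) < (a + a powr ?p / cc) + (b + b powr ?p / cc)"
    using part[of "A \<union> C"] part[of "B \<union> C"] unfolding a_def b_def by fastforce
  also have "\<dots> = (a + b) + (a powr ?p + b powr ?p) / cc" by (simp add: add_divide_distrib)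
  also have "\<dots> \<le> (real n + k - 1) + ((\<nu> + real k - 1) powr ?p + (real n - \<nu>) powr ?p) / cc"
  proof -
    \<comment> \<open>Majorization: \<open>a\<close> equals n - |B| and \<open>b\<close> equals n -
      |A|, so both are at most \<open>n - \<nu>\<close>, and their sum n + |C| is at most n + k -
      1.\<close>
    have "real a powr ?p + real b powr ?p \<le> (\<nu> + real k - 1) powr ?p + (real n - \<nu>) powr ?p"
      using \<nu> C a b nn by (intro sum_powr_le) auto
    then have "(a powr ?p + b powr ?p) / cc
        \<le> ((\<nu> + real k - 1) powr ?p + (real n - \<nu>) powr ?p) / cc"
      using cc by (intro divide_right_mono) auto
    moreover have "real (a + b) \<le> real n + k - 1" using a b nn C by simp
    ultimately show ?thesis by linarith
  qed
  finally have M: "real (card ?E) < (real n + k - 1) + T" unfolding T_def .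
  have n0: "0 < real n" using nn \<nu> by auto
  let ?H = "complement_graph G"
  have "2 * real (card (parcs ?H)) \<le> Q_index (with_proj ?H) * card (pverts ?H)"
    by (rule Q_index_ge_average)
      (use assms(1,4) A0 parts(1) in \<open>auto simp: complement_graph_def sym_def\<close>)
  moreover have "pverts ?H = ?V" by (simp add: complement_graph_def)
  ultimately have "2 * real (card (parcs ?H)) \<le> Q_index (with_proj ?H) * n" using n by simp
  moreover have "real (card (parcs ?H)) = real n * real n - n - card ?E"
  proof -
    have "real (card (parcs ?H) + card ?E + n) = real (n * n)"
      using card_complement_arcs[OF assms(1-3)] n by simp
    then show ?thesis by simp
  qed
  ultimately have "2 * (real n * real n - n - ((real n + k - 1) + T)) < Q_index (with_proj ?H) * n"
    using M by argo
  then have "2 * (real n * real n - n - ((real n + k - 1) + T)) / n < Q_index (with_proj ?H)"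
    using n0 by (simp add: pos_divide_less_eq)
  moreover have "2 * (real n * real n - n - ((real n + k - 1) + (X + Y) / cc)) / n
      = 2 * (real n - 1) - 2 / (real n * cc) * X - 2 / (real n * cc) * Y
        - 2 / real n * (real n + real k - 1)" for X Y
    using n0 cc by (simp add: field_simps)
  ultimately show ?thesis unfolding T_def cc_def[symmetric] by simp
qed

theorem theorem3p3:
  fixes G :: "'a pair_pre_digraph"
    and n \<delta> g k t :: nat
    and \<nu> :: int
  assumes "pair_graph G"
    and "connected (with_proj G)"
    and "n = card (pverts G)"
    and "\<delta> = min_degree (with_proj G)"
    and "\<delta> \<ge> k" and "k \<ge> 2"
    and "girth (with_proj G) = enat g" and "g \<ge> 3"
    and "t = (g - 1) div 2"
    and "\<nu> = nu \<delta> g (k - 1)"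
    and "Q_index (with_proj (complement_graph G)) \<le>
      (if g = 2 * t + 1 then
         2 * (real n - 1)
         - 2 / real n * (of_int \<nu> + real k - 1) powr (1 + 1 / real t)
         - 2 / real n * (real n - of_int \<nu>) powr (1 + 1 / real t)
         - 2 / real n * (real n + real k - 1)
       else
         2 * (real n - 1)
         - 2 / (real n * 2 powr (1 / real t)) * (of_int \<nu> + real k - 1) powr (1 + 1 / real t)
         - 2 / (real n * 2 powr (1 / real t)) * (real n - of_int \<nu>) powr (1 + 1 / real t)
         - 2 / real n * (real n + real k - 1))"
  shows "k_connected k (with_proj G)"
proof (rule ccontr)
  interpret pair_graph G by fact
  let ?V = "pverts G" and ?E = "parcs G"
  assume nk: "\<not> k_connected k (with_proj G)"
  have V: "finite ?V" "?V \<noteq> {}"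
    using assms(2) by (auto simp: connected_def strongly_connected_def)
  have E: "?E \<subseteq> ?V \<times> ?V" "irrefl ?E" "sym ?E"
    using in_arcsD1 in_arcsD2 pair_no_loops pair_sym_arcs
    by (force simp: irrefl_def symmetric_def)+
  have g: "girth_ge g ?E" using girth_ge_parcs[OF _ assms(7)] pair_wf_digraph_axioms by blast
  have deg: "\<delta> \<le> card (?E `` {v})" if "v \<in> ?V" for v
  proof -
    have "out_arcs (with_proj G) v = Pair v ` (?E `` {v})" by (auto simp: out_arcs_def)
    then have "out_degree (with_proj G) v = card (?E `` {v})"
      by (simp add: out_degree_def card_image inj_on_def)
    then show ?thesis
      using that V(1) unfolding assms(4) min_degree_def by (metis Min_le finite_imageI imageI with_proj_simps(1))
  qed
  obtain C where C: "vertex_cut (with_proj G) C" "card C < k"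
    using small_vertex_cut[of "with_proj G" k] V nk by auto
  have CV: "C \<subset> ?V" using C(1) by (simp add: vertex_cut_def)
  have fC: "finite C" using CV V(1) finite_subset by blast
  \<comment> \<open>The case K_1 would leave at most \<open>k\<close> vertices in total, too few for
    a vertex of degree at least \<open>k\<close>.\<close>
  have "card (?V - C) \<noteq> 1"
  proof
    assume "card (?V - C) = 1"
    then have "card ?V \<le> k" using C(2) CV V(1) card_Diff_subset[OF fC, of ?V] by auto
    moreover obtain v where v: "v \<in> ?V" using V by auto
    moreover have "card (?E `` {v}) \<le> card (?V - {v})"
      using E(1,2) V(1) by (intro card_mono) (auto simp: irrefl_def)
    moreover have "card (?V - {v}) < card ?V" using V(1) v by (rule card_Diff1_less)
    ultimately show False using deg[OF v] assms(5) by linarith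
  qed
  with C(1) have "\<not> connected (with_proj G \<restriction> (?V - C))" by (simp add: vertex_cut_def)
  moreover have "?V - C \<noteq> {}" using CV by auto
  ultimately obtain A B where AB: "A \<union> B = ?V - C" "A \<inter> B = {}" "A \<noteq> {}" "B \<noteq> {}"
    "\<And>a b. a \<in> A \<Longrightarrow> b \<in> B \<Longrightarrow> (a, b) \<notin> ?E \<and> (b, a) \<notin> ?E"
    using disconnected_induced_parts[OF pair_wf_digraph_axioms, of "?V - C"] by blast
  have region: "nu \<delta> g (k - 1) \<le> int (card X)" if X: "X = A \<or> X = B" for X
  proof (rule nu_le_card_region[OF V(1) E g assms(8) deg])
    show "b \<in> X \<union> C" if "a \<in> X" "(a, b) \<in> ?E" for a b
    proof -
      have "b \<in> ?V" using that E(1) by auto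
      then have "b \<in> A \<union> B \<union> C" using AB(1) by auto
      with that X AB(5) show ?thesis by blast
    qed
    show "X \<subseteq> ?V" "X \<noteq> {}" using X AB by auto
    show "finite C" "card C \<le> k - 1" "k - 1 < \<delta>" "2 \<le> \<delta>" using fC C(2) assms(5,6) by auto
  qed
  have nu1: "1 \<le> \<nu>"
  proof -
    have "0 \<le> (\<Sum>i<t. (int \<delta> - 1) ^ i)" using assms(5,6) by (intro sum_nonneg) auto
    then show ?thesis
      using assms(5,6) unfolding assms(10) nu_def Let_def assms(9)[symmetric] by auto
  qed
  define c :: nat where "c = (if g = 2 * t + 1 then 1 else 2)"
  have c: "c = 1 \<and> 2 * t < g \<or> c = 2 \<and> 2 * t + 1 < g" "0 < t"
    using assms(8,9) unfolding c_def by auto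
  have "2 * (real n - 1) - 2 / (real n * c powr (1 / t)) * (of_int \<nu> + real k - 1) powr (1 + 1 / t)
    - 2 / (real n * c powr (1 / t)) * (real n - of_int \<nu>) powr (1 + 1 / t)
    - 2 / real n * (real n + real k - 1) < Q_index (with_proj (complement_graph G))"
  proof (rule Q_index_complement_greater[OF V(1) E g c(2,1) assms(3) _ _ _ _ AB(5)])
    show "A \<union> B \<union> C = ?V" "A \<inter> B = {}" "A \<inter> C = {}" "B \<inter> C = {}" using AB(1,2) CV by auto
    show "1 \<le> real_of_int \<nu>" using nu1 by simp
    show "real_of_int \<nu> \<le> real (card A)" "real_of_int \<nu> \<le> real (card B)"
      using region assms(10) by (metis of_int_le_iff of_int_of_nat_eq)+
    show "card C + 1 \<le> k" using C(2) by simp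
  qed
  with assms(11) show False by (auto simp: c_def split: if_splits)
qed

end
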